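(* Let $\nu>0$. Let $(F,W)$, functions of $(r,z,t)$ with $r>0$, $z\in\mathbb R$, be a sufficiently smooth decaying solution of $$\Delta_5W=\partial_z(F^2),\qquad F_t+b_4[W]\cdot\nabla F=\nu\Delta_5F+2W_zF,\qquad b_4[W]=(-rW_z,\ 4W+rW_r).$$ Then $$\frac12\frac{d}{dt}\|F\|_{L^2(d\mu_5)}^2+\nu\|\nabla F\|_{L^2(d\mu_5)}^2=2\|\nabla W\|_{L^2(d\mu_5)}^2 .$$ Moreover, under the rescaling $F_\lambda(r,z,t)=\lambda^2F(\lambda r,\lambda z,\lambda^2t)$, $\lambda>0$, with $W_\lambda$ the decaying solution of $\Delta_5W_\lambda=\partial_z(F_\lambda^2)$, the production term scales like $\lambda^3$ and the viscous term like $\lambda$: $$\|\nabla W_\lambda(t)\|_{L^2(d\mu_5)}^2=\lambda^3\|\nabla W(\lambda^2t)\|_{L^2(d\mu_5)}^2,\qquad \|\nabla F_\lambda(t)\|_{L^2(d\mu_5)}^2=\lambda\|\nabla F(\lambda^2t)\|_{L^2(d\mu_5)}^2 .$$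
   Context: $\nabla=(\partial_r,\partial_z)$, $b\cdot\nabla F=b^rF_r+b^zF_z$, $\Delta_5=\partial_{rr}+\frac3r\partial_r+\partial_{zz}$, $d\mu_5=r^3\,dr\,dz$. Functions of $(r,z)$ are identified with functions on $\mathbb R^5=\mathbb R^4\times\mathbb R$ radial in the first four variables, so $\Delta_5$ is the Laplacian on $\mathbb R^5$. "Sufficiently smooth decaying" means $F,W$ are smooth as functions on $\mathbb R^5$ (in particular regular at $r=0$), all norms are finite, $W$ is the solution of its Poisson equation vanishing at infinity, and decay is fast enough that differentiation under the integral and integrations by parts produce no boundary terms. *)

theory Defs
  imports "HOL-Analysis.Analysis"
begin

text \<open>
  A function of $(r,z)$ is a curried function \<open>real \<Rightarrow> real \<Rightarrow> real\<close>; only its values at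
  \<open>r > 0\<close> matter in every definition below.  A time-dependent function takes the time as its
  first argument, so that \<open>F t\<close> is the profile at time \<open>t\<close>.
\<close>

definition pd_r :: "(real \<Rightarrow> real \<Rightarrow> real) \<Rightarrow> real \<Rightarrow> real \<Rightarrow> real" where
  "pd_r f r z = deriv (\<lambda>s. f s z) r"

definition pd_z :: "(real \<Rightarrow> real \<Rightarrow> real) \<Rightarrow> real \<Rightarrow> real \<Rightarrow> real" where
  "pd_z f r z = deriv (\<lambda>s. f r s) z"

definition grad :: "(real \<Rightarrow> real \<Rightarrow> real) \<Rightarrow> real \<Rightarrow> real \<Rightarrow> real \<times> real" where
  "grad f r z = (pd_r f r z, pd_z f r z)"

definition lap5 :: "(real \<Rightarrow> real \<Rightarrow> real) \<Rightarrow> real \<Rightarrow> real \<Rightarrow> real" where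
  "lap5 f r z = pd_r (pd_r f) r z + 3 / r * pd_r f r z + pd_z (pd_z f) r z"

definition b4 :: "(real \<Rightarrow> real \<Rightarrow> real) \<Rightarrow> real \<Rightarrow> real \<Rightarrow> real \<times> real" where
  "b4 w r z = (- r * pd_z w r z, 4 * w r z + r * pd_r w r z)"

definition mu5 :: "(real \<times> real) measure" where
  "mu5 = density (restrict_space lborel ({0<..} \<times> UNIV)) (\<lambda>(r, z). ennreal (r ^ 3))"

definition in_L2 :: "(real \<Rightarrow> real \<Rightarrow> 'a::real_normed_vector) \<Rightarrow> bool" where
  "in_L2 f \<longleftrightarrow> integrable mu5 (\<lambda>(r, z). (norm (f r z))\<^sup>2)"

definition L2norm :: "(real \<Rightarrow> real \<Rightarrow> 'a::real_normed_vector) \<Rightarrow> real" where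
  "L2norm f = sqrt (\<integral>(r, z). (norm (f r z))\<^sup>2 \<partial>mu5)"

text \<open>\<open>Ck k\<close>: all iterated directional derivatives of order at most \<open>k\<close> exist and are
  continuous (the intermediate ones being Frechet differentiable).\<close>

primrec Ck :: "nat \<Rightarrow> ('a::real_normed_vector \<Rightarrow> 'b::real_normed_vector) \<Rightarrow> bool" where
  "Ck 0 g \<longleftrightarrow> continuous_on UNIV g"
| "Ck (Suc k) g \<longleftrightarrow>
     (\<forall>x. g differentiable (at x)) \<and> (\<forall>v. Ck k (\<lambda>x. frechet_derivative g (at x) v))"

definition smooth :: "('a::real_normed_vector \<Rightarrow> 'b::real_normed_vector) \<Rightarrow> bool" where
  "smooth g \<longleftrightarrow> (\<forall>k. Ck k g)"

text \<open>Smoothness as a function on $\mathbb R^5=\mathbb R^4\times\mathbb R$, radial in the first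
  four variables.  Since a profile lives on \<open>r > 0\<close>, regularity at \<open>r = 0\<close> is the existence of
  a smooth extension across the axis.\<close>

definition smooth5 :: "(real \<Rightarrow> real \<Rightarrow> real) \<Rightarrow> bool" where
  "smooth5 f \<longleftrightarrow>
     (\<exists>g :: (real ^ 4) \<times> real \<Rightarrow> real. smooth g \<and> (\<forall>x z. x \<noteq> 0 \<longrightarrow> g (x, z) = f (norm x) z))"

definition vanishes_at_infinity :: "(real \<Rightarrow> real \<Rightarrow> real) \<Rightarrow> bool" where
  "vanishes_at_infinity f \<longleftrightarrow>
     ((\<lambda>(r, z). f r z) \<longlongrightarrow> 0) (inf at_infinity (principal ({0<..} \<times> UNIV)))"

definition decaying_poisson_solution ::
    "(real \<Rightarrow> real \<Rightarrow> real) \<Rightarrow> (real \<Rightarrow> real \<Rightarrow> real) \<Rightarrow> bool" where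
  "decaying_poisson_solution f w \<longleftrightarrow>
     smooth5 w \<and>
     (\<forall>r>0. \<forall>z. lap5 w r z = pd_z (\<lambda>r z. (f r z)\<^sup>2) r z) \<and>
     vanishes_at_infinity w"

definition solves_system ::
    "real \<Rightarrow> real set \<Rightarrow> (real \<Rightarrow> real \<Rightarrow> real \<Rightarrow> real) \<Rightarrow> (real \<Rightarrow> real \<Rightarrow> real \<Rightarrow> real) \<Rightarrow> bool" where
  "solves_system \<nu> I F W \<longleftrightarrow>
     (\<forall>t\<in>I. smooth5 (F t) \<and> decaying_poisson_solution (F t) (W t) \<and>
        (\<forall>r>0. \<forall>z.
           (\<lambda>s. F s r z) differentiable (at t) \<and>
           deriv (\<lambda>s. F s r z) t + b4 (W t) r z \<bullet> grad (F t) r z =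
             \<nu> * lap5 (F t) r z + 2 * pd_z (W t) r z * F t r z))"

text \<open>Decay allowing differentiation under the integral sign in $\int F^2\,d\mu_5$: near every
  time, $|\partial_t(F^2)|$ has an integrable majorant.\<close>

definition dominated_time_derivative ::
    "real set \<Rightarrow> (real \<Rightarrow> real \<Rightarrow> real \<Rightarrow> real) \<Rightarrow> bool" where
  "dominated_time_derivative I F \<longleftrightarrow>
     (\<forall>t\<in>I. \<exists>\<delta>>0. \<exists>h. integrable mu5 h \<and>
        (\<forall>s\<in>I. \<bar>s - t\<bar> < \<delta> \<longrightarrow>
           (\<forall>r>0. \<forall>z. \<bar>deriv (\<lambda>\<tau>. (F \<tau> r z)\<^sup>2) s\<bar> \<le> h (r, z))))"

text \<open>Decay allowing the integrations by parts: the vector fields whose divergences are integrated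
  are themselves integrable, so that they have no flux through infinity.  The other two fields that
  occur, $F\nabla F$ and $WF^2e_z$, are integrable as soon as \<open>F\<close> and $\nabla F$ are in $L^2$ and
  \<open>W\<close> is bounded.  No rate is prescribed: even for rapidly decreasing \<open>F\<close>, the potential \<open>W\<close> decays
  only like a dipole, $W=O(|x|^{-4})$ and $\nabla W=O(|x|^{-5})$ on $\mathbb R^5$.\<close>

definition integrable_fluxes :: "(real \<Rightarrow> real \<Rightarrow> real) \<Rightarrow> (real \<Rightarrow> real \<Rightarrow> real) \<Rightarrow> bool" where
  "integrable_fluxes f w \<longleftrightarrow>
     integrable mu5 (\<lambda>(r, z). (f r z)\<^sup>2 *\<^sub>R b4 w r z) \<and>
     integrable mu5 (\<lambda>(r, z). w r z *\<^sub>R grad w r z)"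

definition rescale ::
    "real \<Rightarrow> (real \<Rightarrow> real \<Rightarrow> real \<Rightarrow> real) \<Rightarrow> real \<Rightarrow> real \<Rightarrow> real \<Rightarrow> real" where
  "rescale l F t r z = l\<^sup>2 * F (l\<^sup>2 * t) (l * r) (l * z)"

end

theory Submission
  imports Defs
begin

text \<open>
  Energy balance.  In the measure $r^3\,dr\,dz$ the divergence of a field $(P,Q)$ is
  $P_r+\frac3rP+Q_z$.  The drift \<open>b4 w\<close> is divergence free, because the mixed derivatives of \<open>w\<close>
  agree, and $W_zF^2$ is, up to divergences, $-W\,\partial_z(F^2)=-W\Delta_5W$, hence $|\nabla W|^2$.
  Multiplying the equation by \<open>F\<close> therefore gives the pointwise identity
  $$F F_t+\nu|\nabla F|^2-2|\nabla W|^2=\mathrm{div}_5\Phi,\qquad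
    \Phi=-\tfrac12F^2\,b_4[W]+\nu F\nabla F+2WF^2e_z-2W\nabla W ,$$
  and the claim is that the right-hand side has integral zero (\<open>energy_identity\<close>).

  No flux.  Both \<open>\<Phi>\<close> and its divergence are integrable.  On a rectangle in the half-plane the
  integral of the divergence is a sum of four edge integrals.  An integrable field has arbitrarily
  small integrals over suitable lines arbitrarily far away, so three of the edges can be sent to
  infinity along a good sequence without any cutoff function or decay rate.  The fourth edge
  approaches the axis, where \<open>\<Phi>\<close> is bounded and the weight $r^3$ vanishes
  (\<open>integral_divergence_half_plane\<close>, \<open>integral_div5_eq_0\<close>).  The time derivative enters the
  integral of $F^2$ by dominated convergence (\<open>has_derivative_integral_dominated\<close>).

  Scaling.  The function $\lambda^3W(\lambda^2t,\lambda r,\lambda z)$ solves the Poisson equation of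
  the rescaled profile, and the powers of $\lambda$ follow from a change of variables with Jacobian
  $\lambda^5$.  It is the only decaying solution on \<open>r > 0\<close>: the difference of two solutions is
  harmonic and vanishes at infinity.  The maximum principle for it is run inside the half-plane with
  the strictly subharmonic perturbation $r^2+z^2-r^{-2}$, whose last term, harmonic in
  $\mathbb R^4\setminus\{0\}$, keeps the maximum away from the axis (\<open>subharmonic5_nonpos\<close>).
\<close>

section \<open>Profiles smooth up to the axis\<close>

text \<open>
  Schwarz's theorem in two real variables.  The second difference of \<open>f\<close> over a square of side \<open>h\<close>
  equals $h^2$ times either mixed derivative at some point of the square, by two applications of the
  mean value theorem in either order; continuity then gives the limit \<open>h \<rightarrow> 0\<close>.
\<close>

lemma mixed_partials_commute:
  fixes f fx fy fxy fyx :: "real \<Rightarrow> real \<Rightarrow> real"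
  assumes fx: "\<And>x y. ((\<lambda>s. f s y) has_real_derivative fx x y) (at x)"
    and fy: "\<And>x y. ((\<lambda>s. f x s) has_real_derivative fy x y) (at y)"
    and fxy: "\<And>x y. ((\<lambda>s. fx x s) has_real_derivative fxy x y) (at y)"
    and fyx: "\<And>x y. ((\<lambda>s. fy s y) has_real_derivative fyx x y) (at x)"
    and cxy: "isCont (\<lambda>(x, y). fxy x y) (a, b)"
    and cyx: "isCont (\<lambda>(x, y). fyx x y) (a, b)"
  shows "fxy a b = fyx a b"
proof -
  have "\<exists>x y x' y'. a < x \<and> x < a + h \<and> b < y \<and> y < b + h \<and> a < x' \<and> x' < a + h \<and> b < y' \<and> y' < b + h
      \<and> fxy x y = fyx x' y'" if "h > 0" for h
  proof -
    let ?D = "f (a + h) (b + h) - f (a + h) b - f a (b + h) + f a b"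
    have "((\<lambda>s. f s (b + h) - f s b) has_real_derivative fx x (b + h) - fx x b) (at x)" for x
      by (intro DERIV_diff fx)
    then obtain x where x: "a < x" "x < a + h"
      and "(f (a + h) (b + h) - f (a + h) b) - (f a (b + h) - f a b) = (a + h - a) * (fx x (b + h) - fx x b)"
      using MVT2[of a "a + h" "\<lambda>s. f s (b + h) - f s b" "\<lambda>s. fx s (b + h) - fx s b"] \<open>h > 0\<close>
      by auto
    moreover obtain y where y: "b < y" "y < b + h" and "fx x (b + h) - fx x b = (b + h - b) * fxy x y"
      using MVT2[of b "b + h" "\<lambda>s. fx x s" "\<lambda>s. fxy x s"] \<open>h > 0\<close> fxy by auto
    ultimately have 1: "?D = h * (h * fxy x y)" by simp
    have "((\<lambda>s. f (a + h) s - f a s) has_real_derivative fy (a + h) y - fy a y) (at y)" for y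
      by (intro DERIV_diff fy)
    then obtain y' where y': "b < y'" "y' < b + h"
      and "(f (a + h) (b + h) - f a (b + h)) - (f (a + h) b - f a b) = (b + h - b) * (fy (a + h) y' - fy a y')"
      using MVT2[of b "b + h" "\<lambda>s. f (a + h) s - f a s" "\<lambda>s. fy (a + h) s - fy a s"] \<open>h > 0\<close>
      by auto
    moreover obtain x' where x': "a < x'" "x' < a + h" and "fy (a + h) y' - fy a y' = (a + h - a) * fyx x' y'"
      using MVT2[of a "a + h" "\<lambda>s. fy s y'" "\<lambda>s. fyx s y'"] \<open>h > 0\<close> fyx by auto
    ultimately have 2: "?D = h * (h * fyx x' y')" by simp
    from 1 2 \<open>h > 0\<close> have "fxy x y = fyx x' y'" by simp
    with x y x' y' show ?thesis by blast
  qed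
  then have "\<exists>x y x' y'. a < x \<and> x < a + 1 / real (Suc n) \<and> b < y \<and> y < b + 1 / real (Suc n) \<and>
      a < x' \<and> x' < a + 1 / real (Suc n) \<and> b < y' \<and> y' < b + 1 / real (Suc n) \<and> fxy x y = fyx x' y'" for n
    by simp
  then obtain X Y X' Y' where XY: "\<And>n. a < X n \<and> X n < a + 1 / real (Suc n)"
      "\<And>n. b < Y n \<and> Y n < b + 1 / real (Suc n)"
      "\<And>n. a < X' n \<and> X' n < a + 1 / real (Suc n)"
      "\<And>n. b < Y' n \<and> Y' n < b + 1 / real (Suc n)"
      and eq: "\<And>n. fxy (X n) (Y n) = fyx (X' n) (Y' n)"
    by metis
  have lim: "Z \<longlonglongrightarrow> c" if "\<And>n. c < Z n \<and> Z n < c + 1 / real (Suc n)" for Z and c :: real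
  proof (rule tendsto_sandwich[of "\<lambda>_. c" Z])
    show "(\<lambda>n. c + 1 / real (Suc n)) \<longlonglongrightarrow> c"
      using tendsto_add[OF tendsto_const LIMSEQ_inverse_real_of_nat, of c] by (simp add: field_simps)
  qed (use that in \<open>auto intro!: always_eventually less_imp_le\<close>)
  have "(\<lambda>n. (X n, Y n)) \<longlonglongrightarrow> (a, b)" "(\<lambda>n. (X' n, Y' n)) \<longlonglongrightarrow> (a, b)"
    using lim XY by (intro tendsto_Pair; blast)+
  from isCont_tendsto_compose[OF cxy this(1)] isCont_tendsto_compose[OF cyx this(2)]
  show ?thesis using eq LIMSEQ_unique by fastforce
qed

lemma Ck_compose_linear:
  fixes g :: "'b::real_normed_vector \<Rightarrow> real" and L :: "'a::real_normed_vector \<Rightarrow> 'b"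
  assumes "bounded_linear L" "Ck k g"
  shows "Ck k (\<lambda>x. c * g (L x))"
  using assms(2)
proof (induction k arbitrary: g)
  case 0
  then show ?case
    using linear_continuous_on[OF assms(1)]
    by (auto intro!: continuous_intros intro: continuous_on_compose2)
next
  case (Suc k)
  have D: "((\<lambda>x. c * g (L x)) has_derivative (\<lambda>v. c * frechet_derivative g (at (L x)) (L v))) (at x)" for x
  proof -
    have "(g has_derivative frechet_derivative g (at (L x))) (at (L x))"
      using Suc.prems frechet_derivative_works by auto
    from has_derivative_compose[OF bounded_linear_imp_has_derivative[OF assms(1)] this]
    show ?thesis by (rule has_derivative_mult_right)
  qed
  then have "frechet_derivative (\<lambda>x. c * g (L x)) (at x) v = c * frechet_derivative g (at (L x)) (L v)" for x v
    by (metis frechet_derivative_at)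
  moreover have "Ck k (\<lambda>x. c * frechet_derivative g (at (L x)) (L v))" for v
    using Suc.IH[of "\<lambda>y. frechet_derivative g (at y) (L v)"] Suc.prems by simp
  moreover have "(\<lambda>x. c * g (L x)) differentiable (at x)" for x
    using D by (rule differentiableI)
  ultimately show ?case by simp
qed

lemma smooth_compose_linear:
  fixes g :: "'b::real_normed_vector \<Rightarrow> real"
  shows "bounded_linear L \<Longrightarrow> smooth g \<Longrightarrow> smooth (\<lambda>x. c * g (L x))"
  by (simp add: smooth_def Ck_compose_linear)

lemma smooth_frechet_derivative: "smooth g \<Longrightarrow> smooth (\<lambda>x. frechet_derivative g (at x) v)"
  by (metis smooth_def Ck.simps(2))

lemma smooth_has_derivative:
  "smooth g \<Longrightarrow> (g has_derivative frechet_derivative g (at x)) (at x)"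
  by (metis smooth_def Ck.simps(2) frechet_derivative_works)

lemma smooth_continuous_on: "smooth g \<Longrightarrow> continuous_on S g"
  by (metis smooth_def Ck.simps(1) continuous_on_subset subset_UNIV)

text \<open>
  The trace of \<open>smooth5\<close> on a single ray of \<open>\<real>^4\<close>: a smooth extension to the whole \<open>(r, z)\<close>-plane.
  It makes calculus on the half-plane available and bounds a profile and its derivatives on bounded
  sets all the way down to the axis.
\<close>

definition smooth_up_to_axis :: "(real \<Rightarrow> real \<Rightarrow> real) \<Rightarrow> bool" where
  "smooth_up_to_axis f \<longleftrightarrow> (\<exists>g :: real \<times> real \<Rightarrow> real. smooth g \<and> (\<forall>r>0. \<forall>z. f r z = g (r, z)))"

lemma smooth5_imp_smooth_up_to_axis:
  assumes "smooth5 f"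
  shows "smooth_up_to_axis f"
proof -
  obtain g :: "(real ^ 4) \<times> real \<Rightarrow> real" where g: "smooth g" "\<And>x z. x \<noteq> 0 \<Longrightarrow> g (x, z) = f (norm x) z"
    using assms unfolding smooth5_def by blast
  define L :: "real \<times> real \<Rightarrow> (real ^ 4) \<times> real" where "L p = (fst p *\<^sub>R axis 1 1, snd p)" for p
  have "bounded_linear L"
    unfolding L_def by (intro bounded_linear_intros)
  then have "smooth (\<lambda>p. 1 * g (L p))"
    using g(1) by (rule smooth_compose_linear)
  moreover have "f r z = 1 * g (L (r, z))" if "r > 0" for r z
    using that g(2)[of "r *\<^sub>R axis 1 1" z] by (simp add: L_def norm_axis_1)
  ultimately show ?thesis unfolding smooth_up_to_axis_def by blast
qed

lemma smooth_partial_r: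
  fixes g :: "real \<times> real \<Rightarrow> real"
  assumes "smooth g"
  shows "((\<lambda>s. g (s, z)) has_real_derivative frechet_derivative g (at (r, z)) (1, 0)) (at r)"
proof -
  have "((\<lambda>s. (s, z)) has_derivative (\<lambda>h. (h, 0))) (at r)"
    by (auto intro!: derivative_eq_intros)
  from has_derivative_compose[OF this smooth_has_derivative[OF assms]]
  have "((\<lambda>s. g (s, z)) has_derivative (\<lambda>h. frechet_derivative g (at (r, z)) (h, 0))) (at r)" .
  moreover have "(\<lambda>h. frechet_derivative g (at (r, z)) (h, 0)) = (*) (frechet_derivative g (at (r, z)) (1, 0))"
  proof
    fix h
    show "frechet_derivative g (at (r, z)) (h, 0) = frechet_derivative g (at (r, z)) (1, 0) * h"
      using linear_cmul[OF has_derivative_linear[OF smooth_has_derivative[OF assms]], of "(r, z)" h "(1, 0)"]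
      by simp
  qed
  ultimately show ?thesis unfolding has_field_derivative_def by metis
qed

lemma smooth_partial_z:
  fixes g :: "real \<times> real \<Rightarrow> real"
  assumes "smooth g"
  shows "((\<lambda>s. g (r, s)) has_real_derivative frechet_derivative g (at (r, z)) (0, 1)) (at z)"
proof -
  have "((\<lambda>s. (r, s)) has_derivative (\<lambda>h. (0, h))) (at z)"
    by (auto intro!: derivative_eq_intros)
  from has_derivative_compose[OF this smooth_has_derivative[OF assms]]
  have "((\<lambda>s. g (r, s)) has_derivative (\<lambda>h. frechet_derivative g (at (r, z)) (0, h))) (at z)" .
  moreover have "(\<lambda>h. frechet_derivative g (at (r, z)) (0, h)) = (*) (frechet_derivative g (at (r, z)) (0, 1))"
  proof
    fix h
    show "frechet_derivative g (at (r, z)) (0, h) = frechet_derivative g (at (r, z)) (0, 1) * h"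
      using linear_cmul[OF has_derivative_linear[OF smooth_has_derivative[OF assms]], of "(r, z)" h "(0, 1)"]
      by simp
  qed
  ultimately show ?thesis unfolding has_field_derivative_def by metis
qed

lemma DERIV_transform_right_half_line:
  fixes f g :: "real \<Rightarrow> real"
  assumes "(g has_real_derivative D) (at r)" "r > 0" "\<And>s. s > 0 \<Longrightarrow> f s = g s"
  shows "(f has_real_derivative D) (at r)"
  by (rule DERIV_cong_ev[THEN iffD2, OF refl _ refl assms(1)])
     (use assms eventually_gt_at_top in \<open>auto intro!: eventually_mono[OF eventually_nhds_in_open[of "{0<..}"]]\<close>)

lemma smooth_up_to_axis_extension:
  assumes "smooth g" "\<And>r z. r > 0 \<Longrightarrow> f r z = g (r, z)" "r > 0"
  shows "((\<lambda>s. f s z) has_real_derivative frechet_derivative g (at (r, z)) (1, 0)) (at r)"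
    and "((\<lambda>s. f r s) has_real_derivative frechet_derivative g (at (r, z)) (0, 1)) (at z)"
proof -
  show "((\<lambda>s. f s z) has_real_derivative frechet_derivative g (at (r, z)) (1, 0)) (at r)"
    by (rule DERIV_transform_right_half_line[OF smooth_partial_r[OF assms(1)]]) (use assms in auto)
  show "((\<lambda>s. f r s) has_real_derivative frechet_derivative g (at (r, z)) (0, 1)) (at z)"
    using smooth_partial_z[OF assms(1)] assms(2,3) by simp
qed

lemma smooth_up_to_axis_pd_r:
  assumes "smooth_up_to_axis f"
  shows "smooth_up_to_axis (pd_r f)"
proof -
  obtain g :: "real \<times> real \<Rightarrow> real" where g: "smooth g" "\<And>r z. r > 0 \<Longrightarrow> f r z = g (r, z)"
    using assms unfolding smooth_up_to_axis_def by blast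
  have "pd_r f r z = frechet_derivative g (at (r, z)) (1, 0)" if "r > 0" for r z
    unfolding pd_r_def using smooth_up_to_axis_extension(1)[OF g that] by (rule DERIV_imp_deriv)
  with smooth_frechet_derivative[OF g(1)] show ?thesis
    unfolding smooth_up_to_axis_def by blast
qed

lemma smooth_up_to_axis_pd_z:
  assumes "smooth_up_to_axis f"
  shows "smooth_up_to_axis (pd_z f)"
proof -
  obtain g :: "real \<times> real \<Rightarrow> real" where g: "smooth g" "\<And>r z. r > 0 \<Longrightarrow> f r z = g (r, z)"
    using assms unfolding smooth_up_to_axis_def by blast
  have "pd_z f r z = frechet_derivative g (at (r, z)) (0, 1)" if "r > 0" for r z
    unfolding pd_z_def using smooth_up_to_axis_extension(2)[OF g that] by (rule DERIV_imp_deriv)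
  with smooth_frechet_derivative[OF g(1)] show ?thesis
    unfolding smooth_up_to_axis_def by blast
qed

lemma DERIV_pd_r:
  assumes "smooth_up_to_axis f" "r > 0"
  shows "((\<lambda>s. f s z) has_real_derivative pd_r f r z) (at r)"
proof -
  obtain g :: "real \<times> real \<Rightarrow> real" where g: "smooth g" "\<And>r z. r > 0 \<Longrightarrow> f r z = g (r, z)"
    using assms unfolding smooth_up_to_axis_def by blast
  have D: "((\<lambda>s. f s z) has_real_derivative frechet_derivative g (at (r, z)) (1, 0)) (at r)"
    by (rule smooth_up_to_axis_extension(1)[OF g assms(2)])
  then have "pd_r f r z = frechet_derivative g (at (r, z)) (1, 0)"
    unfolding pd_r_def by (rule DERIV_imp_deriv)
  with D show ?thesis by simp
qed

lemma DERIV_pd_z: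
  assumes "smooth_up_to_axis f" "r > 0"
  shows "((\<lambda>s. f r s) has_real_derivative pd_z f r z) (at z)"
proof -
  obtain g :: "real \<times> real \<Rightarrow> real" where g: "smooth g" "\<And>r z. r > 0 \<Longrightarrow> f r z = g (r, z)"
    using assms unfolding smooth_up_to_axis_def by blast
  have D: "((f r) has_real_derivative frechet_derivative g (at (r, z)) (0, 1)) (at z)"
    by (rule smooth_up_to_axis_extension(2)[OF g assms(2)])
  then have "pd_z f r z = frechet_derivative g (at (r, z)) (0, 1)"
    unfolding pd_z_def by (rule DERIV_imp_deriv)
  with D show ?thesis by simp
qed

lemma pd_z_square:
  assumes "smooth_up_to_axis f" "r > 0"
  shows "pd_z (\<lambda>r z. (f r z)\<^sup>2) r z = 2 * f r z * pd_z f r z"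
proof -
  have "((\<lambda>s. (f r s)\<^sup>2) has_real_derivative 2 * f r z * pd_z f r z) (at z)"
    by (rule derivative_eq_intros refl DERIV_pd_z[OF assms])+ simp
  then show ?thesis unfolding pd_z_def[of "\<lambda>r z. (f r z)\<^sup>2"] by (rule DERIV_imp_deriv)
qed

lemma pd_r_pd_z_commute:
  assumes "smooth_up_to_axis f" "r > 0"
  shows "pd_r (pd_z f) r z = pd_z (pd_r f) r z"
proof -
  obtain g :: "real \<times> real \<Rightarrow> real" where g: "smooth g" "\<And>r z. r > 0 \<Longrightarrow> f r z = g (r, z)"
    using assms(1) unfolding smooth_up_to_axis_def by blast
  define gr gz where "gr = (\<lambda>p. frechet_derivative g (at p) (1, 0))"
    and "gz = (\<lambda>p. frechet_derivative g (at p) (0, 1))"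
  have sm: "smooth gr" "smooth gz"
    unfolding gr_def gz_def using g(1) by (auto intro: smooth_frechet_derivative)
  have fr: "pd_r f r z = gr (r, z)" and fz: "pd_z f r z = gz (r, z)" if "r > 0" for r z
    unfolding pd_r_def pd_z_def gr_def gz_def
    using smooth_up_to_axis_extension[OF g that] by (auto intro: DERIV_imp_deriv)
  have "pd_r (pd_z f) r z = frechet_derivative gz (at (r, z)) (1, 0)"
    unfolding pd_r_def using smooth_up_to_axis_extension(1)[OF sm(2) fz assms(2)] by (rule DERIV_imp_deriv)
  moreover have "pd_z (pd_r f) r z = frechet_derivative gr (at (r, z)) (0, 1)"
    unfolding pd_z_def using smooth_up_to_axis_extension(2)[OF sm(1) fr assms(2)] by (rule DERIV_imp_deriv)
  moreover have "frechet_derivative gr (at (r, z)) (0, 1) = frechet_derivative gz (at (r, z)) (1, 0)"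
  proof (rule mixed_partials_commute[where f = "\<lambda>r z. g (r, z)" and fx = "\<lambda>r z. gr (r, z)" and fy = "\<lambda>r z. gz (r, z)"
        and fxy = "\<lambda>r z. frechet_derivative gr (at (r, z)) (0, 1)"
        and fyx = "\<lambda>r z. frechet_derivative gz (at (r, z)) (1, 0)"])
    show "isCont (\<lambda>(x, y). frechet_derivative gr (at (x, y)) (0, 1)) (r, z)"
         "isCont (\<lambda>(x, y). frechet_derivative gz (at (x, y)) (1, 0)) (r, z)"
      using smooth_continuous_on[OF smooth_frechet_derivative[OF sm(1)], of UNIV]
        smooth_continuous_on[OF smooth_frechet_derivative[OF sm(2)], of UNIV]
      by (simp_all add: continuous_on_eq_continuous_at split_beta')
    next
    fix x y
    show "((\<lambda>s. g (s, y)) has_real_derivative gr (x, y)) (at x)"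
      "((\<lambda>s. g (x, s)) has_real_derivative gz (x, y)) (at y)"
      unfolding gr_def gz_def using smooth_partial_r smooth_partial_z g(1) by blast+
    show "((\<lambda>s. gr (x, s)) has_real_derivative frechet_derivative gr (at (x, y)) (0, 1)) (at y)"
      by (rule smooth_partial_z[OF sm(1)])
    show "((\<lambda>s. gz (s, y)) has_real_derivative frechet_derivative gz (at (x, y)) (1, 0)) (at x)"
      by (rule smooth_partial_r[OF sm(2)])
  qed
  ultimately show ?thesis by simp
qed

lemma smooth_up_to_axis_continuous_on:
  assumes "smooth_up_to_axis f"
  shows "continuous_on ({0<..} \<times> UNIV) (\<lambda>(r, z). f r z)"
proof -
  obtain g :: "real \<times> real \<Rightarrow> real" where g: "smooth g" "\<And>r z. r > 0 \<Longrightarrow> f r z = g (r, z)"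
    using assms(1) unfolding smooth_up_to_axis_def by blast
  have "continuous_on ({0<..} \<times> UNIV) g"
    by (rule smooth_continuous_on[OF g(1)])
  then show ?thesis
    by (rule continuous_on_eq) (use g(2) in auto)
qed

text \<open>
  The bound holds down to the axis because the extension is continuous on the compact rectangle that
  includes \<open>r = 0\<close>.
\<close>

lemma smooth_up_to_axis_bounded:
  assumes "smooth_up_to_axis f"
  shows "\<exists>M>0. \<forall>r z. 0 < r \<and> r \<le> R \<and> \<bar>z\<bar> \<le> S \<longrightarrow> \<bar>f r z\<bar> \<le> M"
proof -
  obtain g :: "real \<times> real \<Rightarrow> real" where g: "smooth g" "\<And>r z. r > 0 \<Longrightarrow> f r z = g (r, z)"
    using assms(1) unfolding smooth_up_to_axis_def by blast
  have "compact (g ` ({0..R} \<times> {-S..S}))"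
    by (intro compact_continuous_image smooth_continuous_on[OF g(1)] compact_Times compact_Icc)
  then obtain M where M: "M > 0" "\<And>y. y \<in> g ` ({0..R} \<times> {-S..S}) \<Longrightarrow> norm y \<le> M"
    using bounded_pos compact_imp_bounded by metis
  have "\<bar>f r z\<bar> \<le> M" if "0 < r" "r \<le> R" "\<bar>z\<bar> \<le> S" for r z
  proof -
    have "(r, z) \<in> {0..R} \<times> {-S..S}" using that by auto
    then show ?thesis using M(2)[OF imageI] g(2) that by fastforce
  qed
  with M(1) show ?thesis by blast
qed

section \<open>Divergences on the half-plane\<close>

abbreviation half_plane :: "(real \<times> real) set" where
  "half_plane \<equiv> {0<..} \<times> UNIV"

lemma sets_half_plane [measurable, simp]: "half_plane \<in> sets borel"
  by (intro borel_open open_Times) auto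

text \<open>
  Otherwise \<open>f \<ge> e\<close> on a half-line, which has infinite measure.  Applied to the integrals of an
  integrable field over parallel lines, this produces distant lines with small flux.
\<close>

lemma nn_integral_finite_small_value_at_top:
  fixes f :: "real \<Rightarrow> ennreal"
  assumes [measurable]: "f \<in> borel_measurable borel"
    and fin: "(\<integral>\<^sup>+x. f x \<partial>lborel) < \<infinity>" and "e > 0"
  shows "\<exists>x>N. f x < ennreal e"
proof (rule ccontr)
  assume small: "\<not> ?thesis"
  have ge: "ennreal e \<le> f x" if "x > N" for x
    using small that leI by blast
  define c where "c = enn2real (\<integral>\<^sup>+x. f x \<partial>lborel)"
  have c: "(\<integral>\<^sup>+x. f x \<partial>lborel) = ennreal c" "c \<ge> 0"
    using fin by (auto simp: c_def)
  define k where "k = c / e + 1"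
  have "k > 0" using c \<open>e > 0\<close> by (simp add: k_def add_nonneg_pos)
  have "ennreal e * ennreal k = (\<integral>\<^sup>+x. ennreal e * indicator {N<..N + k} x \<partial>lborel)"
    using \<open>k > 0\<close> by (simp add: nn_integral_cmult_indicator)
  also have "\<dots> \<le> (\<integral>\<^sup>+x. f x \<partial>lborel)"
    by (intro nn_integral_mono) (auto split: split_indicator intro: ge)
  finally have "e * k \<le> c"
    using c \<open>e > 0\<close> \<open>k > 0\<close> by (simp add: ennreal_mult[symmetric])
  moreover have "e * k = c + e" using \<open>e > 0\<close> by (simp add: k_def field_simps)
  ultimately show False using \<open>e > 0\<close> by simp
qed

lemma nn_integral_finite_small_value_at_bot:
  fixes f :: "real \<Rightarrow> ennreal"
  assumes [measurable]: "f \<in> borel_measurable borel"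
    and fin: "(\<integral>\<^sup>+x. f x \<partial>lborel) < \<infinity>" and "e > 0"
  shows "\<exists>x. x < - N \<and> f x < ennreal e"
proof -
  have "(\<integral>\<^sup>+x. f (- x) \<partial>lborel) < \<infinity>"
    using fin nn_integral_real_affine[of f "-1" 0] by simp
  from nn_integral_finite_small_value_at_top[OF _ this \<open>e > 0\<close>, of N]
  obtain x where "x > N" "f (- x) < ennreal e" by auto
  then show ?thesis by (intro exI[of _ "- x"]) auto
qed

text \<open>
  Bounds an integral over one edge of a rectangle by the integral of the field over the whole line
  that contains the edge; \<open>g\<close> stands for the extension of the field by zero.
\<close>

lemma abs_integral_le_nn_integral:
  fixes f g :: "real \<Rightarrow> real"
  assumes cont: "continuous_on {a..b} f"
    and eq: "\<And>x. x \<in> {a..b} \<Longrightarrow> g x = f x"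
  shows "ennreal \<bar>integral {a..b} f\<bar> \<le> (\<integral>\<^sup>+x. ennreal \<bar>g x\<bar> \<partial>lborel)"
proof -
  have int: "set_integrable lborel {a..b} f"
    by (rule borel_integrable_atLeastAtMost'[OF cont])
  have "ennreal \<bar>integral {a..b} f\<bar> = ennreal (norm (LINT x|lborel. indicator {a..b} x *\<^sub>R f x))"
    using set_borel_integral_eq_integral(2)[OF int] by (simp add: set_lebesgue_integral_def)
  also have "\<dots> \<le> (\<integral>\<^sup>+x. ennreal (norm (indicator {a..b} x *\<^sub>R f x)) \<partial>lborel)"
    using int unfolding set_integrable_def by (rule integral_norm_bound_ennreal)
  also have "\<dots> \<le> (\<integral>\<^sup>+x. ennreal \<bar>g x\<bar> \<partial>lborel)"
    by (intro nn_integral_mono) (auto split: split_indicator simp: eq)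
  finally show ?thesis .
qed

lemma integral_divergence_rectangle:
  fixes G Gr H Hz :: "real \<Rightarrow> real \<Rightarrow> real"
  assumes "0 < a" "a \<le> b" "c \<le> d"
    and G: "\<And>r z. r > 0 \<Longrightarrow> ((\<lambda>s. G s z) has_real_derivative Gr r z) (at r)"
    and H: "\<And>r z. r > 0 \<Longrightarrow> ((\<lambda>s. H r s) has_real_derivative Hz r z) (at z)"
    and cont: "continuous_on half_plane (\<lambda>(r, z). Gr r z)" "continuous_on half_plane (\<lambda>(r, z). Hz r z)"
  shows "integral (cbox (a, c) (b, d)) (\<lambda>(r, z). Gr r z + Hz r z) =
    integral {c..d} (\<lambda>z. G b z - G a z) + integral {a..b} (\<lambda>r. H r d - H r c)"
proof -
  have sub: "cbox (a, c) (b, d) \<subseteq> half_plane"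
    using \<open>0 < a\<close> by (auto simp: cbox_Pair_eq)
  note cont' = cont[THEN continuous_on_subset, OF sub]
  have "integral (cbox (a, c) (b, d)) (\<lambda>(r, z). Gr r z + Hz r z) =
      integral (cbox (a, c) (b, d)) (\<lambda>(r, z). Gr r z) + integral (cbox (a, c) (b, d)) (\<lambda>(r, z). Hz r z)"
    using integral_add[OF cont'[THEN integrable_continuous]] by (simp add: split_beta')
  also have "integral (cbox (a, c) (b, d)) (\<lambda>(r, z). Gr r z) = integral {c..d} (\<lambda>z. integral {a..b} (\<lambda>r. Gr r z))"
    using integral_prod_continuous[OF cont'(1)] integral_swap_continuous[OF cont'(1)] by simp
  also have "\<dots> = integral {c..d} (\<lambda>z. G b z - G a z)"
  proof (rule integral_cong)
    fix z
    have "((\<lambda>r. Gr r z) has_integral G b z - G a z) {a..b}"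
      by (rule fundamental_theorem_of_calculus[OF \<open>a \<le> b\<close>])
        (use \<open>0 < a\<close> G in \<open>auto simp flip: has_real_derivative_iff_has_vector_derivative
          intro: has_field_derivative_at_within\<close>)
    then show "integral {a..b} (\<lambda>r. Gr r z) = G b z - G a z" by (rule integral_unique)
  qed
  also have "integral (cbox (a, c) (b, d)) (\<lambda>(r, z). Hz r z) = integral {a..b} (\<lambda>r. integral {c..d} (Hz r))"
    using integral_prod_continuous[OF cont'(2)] by simp
  also have "\<dots> = integral {a..b} (\<lambda>r. H r d - H r c)"
  proof (rule integral_cong)
    fix r assume "r \<in> {a..b}"
    then have "(Hz r has_integral H r d - H r c) {c..d}"
      by (intro fundamental_theorem_of_calculus[OF \<open>c \<le> d\<close>])
        (use \<open>0 < a\<close> H in \<open>auto simp flip: has_real_derivative_iff_has_vector_derivative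
          intro: has_field_derivative_at_within\<close>)
    then show "integral {c..d} (Hz r) = H r d - H r c" by (rule integral_unique)
  qed
  finally show ?thesis .
qed

lemma continuous_on_half_plane_slices:
  assumes "continuous_on half_plane (\<lambda>(r, z). f r z)"
  shows "r > 0 \<Longrightarrow> continuous_on S (f r)"
    and "a > 0 \<Longrightarrow> continuous_on {a..b} (\<lambda>r. f r z)"
proof -
  assume "r > 0"
  then show "continuous_on S (f r)"
    using continuous_on_compose2[OF assms, of S "\<lambda>z. (r, z)"]
    by (simp add: continuous_on_Pair continuous_on_const continuous_on_id image_subset_iff)
next
  assume "a > 0"
  then show "continuous_on {a..b} (\<lambda>r. f r z)"
    using continuous_on_compose2[OF assms, of "{a..b}" "\<lambda>r. (r, z)"]
    by (simp add: continuous_on_Pair continuous_on_const continuous_on_id image_subset_iff)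
qed

text \<open>
  An integrable field with integrable divergence has no flux through infinity.  The rectangles are
  chosen so that their right, lower and upper edges lie on lines over which the field has small
  integral; the left edge is moved to the axis only after the other three are fixed, so that the
  bound \<open>G = O(r)\<close> on its finite length suffices.
\<close>

lemma integral_divergence_half_plane:
  fixes G Gr H Hz :: "real \<Rightarrow> real \<Rightarrow> real"
  assumes G: "\<And>r z. r > 0 \<Longrightarrow> ((\<lambda>s. G s z) has_real_derivative Gr r z) (at r)"
    and H: "\<And>r z. r > 0 \<Longrightarrow> ((\<lambda>s. H r s) has_real_derivative Hz r z) (at z)"
    and contG: "continuous_on half_plane (\<lambda>(r, z). G r z)" and contH: "continuous_on half_plane (\<lambda>(r, z). H r z)"
    and cont: "continuous_on half_plane (\<lambda>(r, z). Gr r z)" "continuous_on half_plane (\<lambda>(r, z). Hz r z)"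
    and intG: "set_integrable lborel half_plane (\<lambda>(r, z). G r z)"
    and intH: "set_integrable lborel half_plane (\<lambda>(r, z). H r z)"
    and intD: "set_integrable lborel half_plane (\<lambda>(r, z). Gr r z + Hz r z)"
    and axis: "\<And>S. \<exists>M>0. \<forall>r z. 0 < r \<and> r \<le> 1 \<and> \<bar>z\<bar> \<le> S \<longrightarrow> \<bar>G r z\<bar> \<le> M * r"
  shows "(LINT (r, z):half_plane|lborel. Gr r z + Hz r z) = 0"
proof -
  define G' H' where "G' = (\<lambda>p. indicator half_plane p *\<^sub>R (\<lambda>(r, z). G r z) p)"
    and "H' = (\<lambda>p. indicator half_plane p *\<^sub>R (\<lambda>(r, z). H r z) p)"
  have [measurable]: "G' \<in> borel_measurable (lborel \<Otimes>\<^sub>M lborel)" "H' \<in> borel_measurable (lborel \<Otimes>\<^sub>M lborel)"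
    using intG intH unfolding set_integrable_def G'_def H'_def lborel_prod by auto
  define A where "A r = (\<integral>\<^sup>+z. ennreal \<bar>G' (r, z)\<bar> \<partial>lborel)" for r
  define B where "B z = (\<integral>\<^sup>+r. ennreal \<bar>H' (r, z)\<bar> \<partial>lborel)" for z
  have fin: "(\<integral>\<^sup>+p. ennreal \<bar>G' p\<bar> \<partial>(lborel \<Otimes>\<^sub>M lborel)) < \<infinity>" "(\<integral>\<^sup>+p. ennreal \<bar>H' p\<bar> \<partial>(lborel \<Otimes>\<^sub>M lborel)) < \<infinity>"
    using intG intH unfolding set_integrable_def G'_def H'_def integrable_iff_bounded lborel_prod by auto
  have [measurable]: "A \<in> borel_measurable borel" "B \<in> borel_measurable borel"
    unfolding A_def B_def by measurable
  have A: "(\<integral>\<^sup>+r. A r \<partial>lborel) < \<infinity>"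
    unfolding A_def using fin(1) lborel.nn_integral_fst[of "\<lambda>p. ennreal \<bar>G' p\<bar>" lborel] by simp
  have B: "(\<integral>\<^sup>+z. B z \<partial>lborel) < \<infinity>"
    unfolding B_def using fin(2) lborel_pair.nn_integral_snd[of "\<lambda>p. ennreal \<bar>H' p\<bar>"] by simp
  let ?D = "\<lambda>(r, z). Gr r z + Hz r z"
  define good where "good n a b c d \<longleftrightarrow> 0 < a \<and> a < 1 / real (Suc n) \<and> real (Suc n) < b \<and>
      c < - real (Suc n) \<and> real (Suc n) < d \<and> \<bar>integral (cbox (a, c) (b, d)) ?D\<bar> \<le> 4 / real (Suc n)" for n a b c d
  have "\<exists>a b c d. good n a b c d" for n
  proof -
    define e where "e = 1 / real (Suc n)"
    have "e > 0" "e \<le> 1" by (auto simp: e_def)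
    obtain b where b: "b > real (Suc n)" "A b < ennreal e"
      using nn_integral_finite_small_value_at_top[OF _ A \<open>e > 0\<close>] by auto
    obtain d where d: "d > real (Suc n)" "B d < ennreal e"
      using nn_integral_finite_small_value_at_top[OF _ B \<open>e > 0\<close>] by auto
    obtain c where c: "c < - real (Suc n)" "B c < ennreal e"
      using nn_integral_finite_small_value_at_bot[OF _ B \<open>e > 0\<close>, of "real (Suc n)"] by auto
    obtain M where M: "M > 0" "\<And>r z. 0 < r \<Longrightarrow> r \<le> 1 \<Longrightarrow> \<bar>z\<bar> \<le> max d (- c) \<Longrightarrow> \<bar>G r z\<bar> \<le> M * r"
      using axis[of "max d (- c)"] by blast
    \<comment> \<open>The flux through the left edge, of length \<open>d - c\<close>, is at most \<open>M * a * (d - c)\<close>.\<close>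
    define a where "a = min (e / 2) (e / (M * (d - c)))"
    have "c < d" using c d by simp
    then have Mdc: "M * (d - c) > 0" using \<open>M > 0\<close> by simp
    have a: "0 < a" "a < e" "a \<le> 1" "a * (M * (d - c)) \<le> e"
    proof -
      show "0 < a" using \<open>e > 0\<close> Mdc unfolding a_def by simp
      show "a < e" "a \<le> 1" using \<open>e > 0\<close> \<open>e \<le> 1\<close> by (auto simp: a_def)
      have "a \<le> e / (M * (d - c))" by (simp add: a_def)
      then show "a * (M * (d - c)) \<le> e" using Mdc by (simp add: pos_le_divide_eq)
    qed
    have "b > 1" using b(1) by simp
    have "a \<le> b" using a \<open>b > 1\<close> by simp
    have Gc: "continuous_on {c..d} (G r)" if "r > 0" for r
      using continuous_on_half_plane_slices(1)[OF contG that] .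
    have Hc: "continuous_on {a..b} (\<lambda>r. H r z)" for z
      using continuous_on_half_plane_slices(2)[OF contH \<open>0 < a\<close>] .
    have right: "\<bar>integral {c..d} (G b)\<bar> \<le> e"
    proof -
      have "ennreal \<bar>integral {c..d} (G b)\<bar> \<le> A b"
        unfolding A_def by (rule abs_integral_le_nn_integral) (use \<open>b > 1\<close> Gc in \<open>auto simp: G'_def\<close>)
      with b(2) have "ennreal \<bar>integral {c..d} (G b)\<bar> \<le> ennreal e" by (meson le_less_trans less_imp_le)
      with \<open>e > 0\<close> show ?thesis by (simp add: ennreal_le_iff)
    qed
    have horizontal: "\<bar>integral {a..b} (\<lambda>r. H r z)\<bar> \<le> e" if "B z < ennreal e" for z
    proof -
      have "ennreal \<bar>integral {a..b} (\<lambda>r. H r z)\<bar> \<le> B z"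
        unfolding B_def by (rule abs_integral_le_nn_integral) (use \<open>0 < a\<close> Hc in \<open>auto simp: H'_def\<close>)
      with that have "ennreal \<bar>integral {a..b} (\<lambda>r. H r z)\<bar> \<le> ennreal e" by (meson le_less_trans less_imp_le)
      with \<open>e > 0\<close> show ?thesis by (simp add: ennreal_le_iff)
    qed
    have left: "\<bar>integral {c..d} (G a)\<bar> \<le> e"
    proof -
      have "norm (integral {c..d} (G a)) \<le> (M * a) * (d - c)"
        by (rule integral_bound) (use \<open>c < d\<close> Gc a M in auto)
      also have "\<dots> \<le> e" using a(4) by (simp add: algebra_simps)
      finally show ?thesis by simp
    qed
    have "integral (cbox (a, c) (b, d)) ?D = integral {c..d} (\<lambda>z. G b z - G a z) + integral {a..b} (\<lambda>r. H r d - H r c)"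
      by (rule integral_divergence_rectangle[OF \<open>0 < a\<close> \<open>a \<le> b\<close> _ G H cont]) (use \<open>c < d\<close> in auto)
    also have "integral {c..d} (\<lambda>z. G b z - G a z) = integral {c..d} (G b) - integral {c..d} (G a)"
      using Gc \<open>0 < a\<close> \<open>b > 1\<close> by (intro Henstock_Kurzweil_Integration.integral_diff integrable_continuous_real) auto
    also have "integral {a..b} (\<lambda>r. H r d - H r c) = integral {a..b} (\<lambda>r. H r d) - integral {a..b} (\<lambda>r. H r c)"
      using Hc by (intro Henstock_Kurzweil_Integration.integral_diff integrable_continuous_real) auto
    finally have "\<bar>integral (cbox (a, c) (b, d)) ?D\<bar> \<le> 4 * e"
      using left right horizontal[OF c(2)] horizontal[OF d(2)] by linarith
    then show ?thesis using a b c d unfolding e_def good_def by (intro exI[of _ a] exI[of _ b] exI[of _ c] exI[of _ d]) auto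
  qed
  then obtain a b c d where "\<And>n. good n (a n) (b n) (c n) (d n)"
    by metis
  note box = this[unfolded good_def]
  define Q where "Q n = cbox (a n, c n) (b n, d n)" for n
  have sub: "Q n \<subseteq> half_plane" for n
    using box[of n] by (auto simp: Q_def cbox_Pair_eq)
  have "(\<lambda>n. LINT p|lborel. indicator (Q n) p *\<^sub>R ?D p) \<longlonglongrightarrow> (LINT p|lborel. indicator half_plane p *\<^sub>R ?D p)"
  proof (rule integral_dominated_convergence)
    show "(\<lambda>p. indicator half_plane p *\<^sub>R ?D p) \<in> borel_measurable lborel"
      using intD by (auto simp: set_integrable_def)
    show "integrable lborel (\<lambda>p. norm (indicator half_plane p *\<^sub>R ?D p))"
      using intD unfolding set_integrable_def by (rule integrable_norm)
    show "(\<lambda>p. indicator (Q n) p *\<^sub>R ?D p) \<in> borel_measurable lborel" for n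
      using set_integrable_subset[OF intD _ sub, of n] by (auto simp: set_integrable_def Q_def)
    show "AE p in lborel. norm (indicator (Q n) p *\<^sub>R ?D p) \<le> norm (indicator half_plane p *\<^sub>R ?D p)" for n
      using sub[of n] by (intro AE_I2) (auto split: split_indicator)
    show "AE p in lborel. (\<lambda>n. indicator (Q n) p *\<^sub>R ?D p) \<longlonglongrightarrow> indicator half_plane p *\<^sub>R ?D p"
    proof (intro AE_I2)
      fix p :: "real \<times> real"
      obtain r z where p: "p = (r, z)" by (cases p)
      have "\<forall>\<^sub>F n in sequentially. indicator (Q n) p *\<^sub>R ?D p = indicator half_plane p *\<^sub>R ?D p"
      proof (cases "p \<in> half_plane")
        case True
        then have "r > 0" by (simp add: p)
        obtain N where N: "max (1 / r) (max r \<bar>z\<bar>) < real N" using reals_Archimedean2 by blast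
        have "p \<in> Q n" if "n \<ge> N" for n
        proof -
          have n: "1 / r < real (Suc n)" "r < real (Suc n)" "\<bar>z\<bar> < real (Suc n)" using N that by auto
          then have "1 / real (Suc n) < r" using \<open>r > 0\<close> by (simp add: field_simps)
          then show ?thesis using box[of n] n unfolding Q_def p cbox_Pair_eq by auto
        qed
        then show ?thesis using True by (auto intro!: eventually_sequentiallyI[of N])
      next
        case False
        then show ?thesis using sub by (auto intro!: always_eventually split: split_indicator)
      qed
      then show "(\<lambda>n. indicator (Q n) p *\<^sub>R ?D p) \<longlonglongrightarrow> indicator half_plane p *\<^sub>R ?D p"
        by (rule tendsto_eventually)
    qed
  qed
  moreover have "(\<lambda>n. LINT p|lborel. indicator (Q n) p *\<^sub>R ?D p) \<longlonglongrightarrow> 0"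
  proof (rule Lim_null_comparison)
    have "(LINT p|lborel. indicator (Q n) p *\<^sub>R ?D p) = integral (Q n) ?D" for n
      using set_borel_integral_eq_integral(2)[OF set_integrable_subset[OF intD _ sub, of n]]
      by (simp add: set_lebesgue_integral_def Q_def)
    then show "\<forall>\<^sub>F n in sequentially. norm (LINT p|lborel. indicator (Q n) p *\<^sub>R ?D p) \<le> 4 / real (Suc n)"
      using box by (auto simp: Q_def intro!: always_eventually)
    show "(\<lambda>n. 4 / real (Suc n)) \<longlonglongrightarrow> 0"
      using tendsto_mult_right_zero[OF LIMSEQ_inverse_real_of_nat, of 4] by (simp add: field_simps)
  qed
  ultimately show ?thesis
    unfolding set_lebesgue_integral_def by (rule LIMSEQ_unique)
qed

section \<open>The weighted measure and its divergence theorem\<close>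

lemma borel_measurable_mu5_iff:
  fixes f :: "real \<times> real \<Rightarrow> 'a::real_normed_vector"
  shows "f \<in> borel_measurable mu5 \<longleftrightarrow> (\<lambda>p. indicator half_plane p *\<^sub>R f p) \<in> borel_measurable borel"
proof -
  have "f \<in> borel_measurable mu5 \<longleftrightarrow> f \<in> borel_measurable (restrict_space lborel half_plane)"
    unfolding mu5_def by simp
  also have "\<dots> \<longleftrightarrow> (\<lambda>p. indicator half_plane p *\<^sub>R f p) \<in> borel_measurable lborel"
    by (rule borel_measurable_restrict_space_iff) simp
  finally show ?thesis by simp
qed

lemma continuous_on_imp_measurable_mu5:
  fixes f :: "real \<times> real \<Rightarrow> 'a::real_normed_vector"
  shows "continuous_on half_plane f \<Longrightarrow> f \<in> borel_measurable mu5"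
  unfolding borel_measurable_mu5_iff by (intro borel_measurable_continuous_on_indicator) simp

lemma space_mu5: "space mu5 = half_plane"
  by (simp add: mu5_def space_restrict_space)

lemma mu5_weight_eq:
  "mu5 = density (restrict_space lborel half_plane) (\<lambda>p. ennreal (fst p ^ 3))"
  by (simp add: mu5_def split_beta')

lemma
  fixes f :: "real \<times> real \<Rightarrow> 'a::{banach, second_countable_topology}"
  assumes "f \<in> borel_measurable mu5"
  shows integrable_mu5_iff: "integrable mu5 f \<longleftrightarrow> set_integrable lborel half_plane (\<lambda>p. fst p ^ 3 *\<^sub>R f p)"
    and integral_mu5: "integral\<^sup>L mu5 f = (LINT p:half_plane|lborel. fst p ^ 3 *\<^sub>R f p)"
proof -
  have f: "f \<in> borel_measurable (restrict_space lborel half_plane)"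
    using assms unfolding mu5_def by simp
  have w: "(\<lambda>p. fst p ^ 3) \<in> borel_measurable (restrict_space lborel half_plane)"
    by (intro measurable_restrict_space1) (auto intro!: borel_measurable_continuous_onI continuous_intros)
  have nn: "AE p in restrict_space lborel half_plane. 0 \<le> fst p ^ 3"
    by (intro AE_I2) (auto simp: space_restrict_space)
  show "integrable mu5 f \<longleftrightarrow> set_integrable lborel half_plane (\<lambda>p. fst p ^ 3 *\<^sub>R f p)"
    unfolding mu5_weight_eq set_integrable_def
    by (subst integrable_density[OF f w nn], subst integrable_restrict_space) auto
  show "integral\<^sup>L mu5 f = (LINT p:half_plane|lborel. fst p ^ 3 *\<^sub>R f p)"
    unfolding mu5_weight_eq set_lebesgue_integral_def
    by (subst integral_density[OF f w nn], subst integral_restrict_space) auto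
qed

text \<open>
  The divergence in \<open>mu5\<close> is $r^{-3}(\partial_r(r^3P)+\partial_z(r^3Q))$, so the weight turns it into
  the flat divergence of $(r^3P,r^3Q)$.  Boundedness of \<open>P\<close> near the axis makes the weighted first
  component vanish there.
\<close>

lemma integral_div5_eq_0:
  fixes P Pr Q Qz :: "real \<Rightarrow> real \<Rightarrow> real"
  assumes P: "\<And>r z. r > 0 \<Longrightarrow> ((\<lambda>s. P s z) has_real_derivative Pr r z) (at r)"
    and Q: "\<And>r z. r > 0 \<Longrightarrow> ((\<lambda>s. Q r s) has_real_derivative Qz r z) (at z)"
    and cont: "continuous_on half_plane (\<lambda>(r, z). P r z)" "continuous_on half_plane (\<lambda>(r, z). Q r z)"
      "continuous_on half_plane (\<lambda>(r, z). Pr r z)" "continuous_on half_plane (\<lambda>(r, z). Qz r z)"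
    and int: "integrable mu5 (\<lambda>(r, z). P r z)" "integrable mu5 (\<lambda>(r, z). Q r z)"
      "integrable mu5 (\<lambda>(r, z). Pr r z + 3 / r * P r z + Qz r z)"
    and axis: "\<And>S. \<exists>M>0. \<forall>r z. 0 < r \<and> r \<le> 1 \<and> \<bar>z\<bar> \<le> S \<longrightarrow> \<bar>P r z\<bar> \<le> M"
  shows "(\<integral>(r, z). Pr r z + 3 / r * P r z + Qz r z \<partial>mu5) = 0"
proof -
  define G Gr H Hz where "G = (\<lambda>r z. r ^ 3 * P r z)" and "Gr = (\<lambda>r z. 3 * r\<^sup>2 * P r z + r ^ 3 * Pr r z)"
    and "H = (\<lambda>r z. r ^ 3 * Q r z)" and "Hz = (\<lambda>r z. r ^ 3 * Qz r z)"
  note cont' = cont[unfolded split_beta']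
  have cD: "continuous_on half_plane (\<lambda>(r, z). Pr r z + 3 / r * P r z + Qz r z)"
    unfolding split_beta' by (intro continuous_intros cont') auto
  have wD: "fst p ^ 3 *\<^sub>R (\<lambda>(r, z). Pr r z + 3 / r * P r z + Qz r z) p = (\<lambda>(r, z). Gr r z + Hz r z) p"
    if "p \<in> half_plane" for p
    using that by (auto simp: Gr_def Hz_def field_simps power2_eq_square power3_eq_cube)
  have wP: "(\<lambda>p. fst p ^ 3 *\<^sub>R (\<lambda>(r, z). P r z) p) = (\<lambda>(r, z). G r z)"
    and wQ: "(\<lambda>p. fst p ^ 3 *\<^sub>R (\<lambda>(r, z). Q r z) p) = (\<lambda>(r, z). H r z)"
    by (auto simp: G_def H_def)
  have "(\<integral>(r, z). Pr r z + 3 / r * P r z + Qz r z \<partial>mu5) = (LINT (r, z):half_plane|lborel. Gr r z + Hz r z)"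
    using wD unfolding integral_mu5[OF continuous_on_imp_measurable_mu5[OF cD]]
    by (intro set_lebesgue_integral_cong) auto
  also have "\<dots> = 0"
  proof (rule integral_divergence_half_plane[of G Gr H Hz])
    fix r z :: real
    assume "r > 0"
    show "((\<lambda>s. G s z) has_real_derivative Gr r z) (at r)"
      unfolding G_def Gr_def
      by (rule derivative_eq_intros refl P \<open>r > 0\<close>)+ (simp add: power2_eq_square algebra_simps)
    show "((\<lambda>s. H r s) has_real_derivative Hz r z) (at z)"
      unfolding H_def Hz_def by (rule derivative_eq_intros refl Q \<open>r > 0\<close>)+ simp
  next
    show "continuous_on half_plane (\<lambda>(r, z). G r z)" "continuous_on half_plane (\<lambda>(r, z). H r z)"
      "continuous_on half_plane (\<lambda>(r, z). Gr r z)" "continuous_on half_plane (\<lambda>(r, z). Hz r z)"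
      unfolding G_def H_def Gr_def Hz_def split_beta' by (intro continuous_intros cont')+
    show "set_integrable lborel half_plane (\<lambda>(r, z). G r z)"
      using int(1) unfolding integrable_mu5_iff[OF continuous_on_imp_measurable_mu5[OF cont(1)]] wP .
    show "set_integrable lborel half_plane (\<lambda>(r, z). H r z)"
      using int(2) unfolding integrable_mu5_iff[OF continuous_on_imp_measurable_mu5[OF cont(2)]] wQ .
    show "set_integrable lborel half_plane (\<lambda>(r, z). Gr r z + Hz r z)"
      using int(3) unfolding integrable_mu5_iff[OF continuous_on_imp_measurable_mu5[OF cD]]
      by (rule iffD1[OF set_integrable_cong, rotated -1]) (use wD in auto)
    fix S :: real
    obtain M where M: "M > 0" "\<And>r z. 0 < r \<Longrightarrow> r \<le> 1 \<Longrightarrow> \<bar>z\<bar> \<le> S \<Longrightarrow> \<bar>P r z\<bar> \<le> M"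
      using axis[of S] by blast
    have "\<bar>G r z\<bar> \<le> M * r" if "0 < r" "r \<le> 1" "\<bar>z\<bar> \<le> S" for r z
    proof -
      have "\<bar>G r z\<bar> = r ^ 3 * \<bar>P r z\<bar>" using that by (simp add: G_def abs_mult)
      also have "\<dots> \<le> r * M"
        using that M power_decreasing[of 1 3 r] by (intro mult_mono) auto
      finally show ?thesis by (simp add: mult.commute)
    qed
    with M(1) show "\<exists>M>0. \<forall>r z. 0 < r \<and> r \<le> 1 \<and> \<bar>z\<bar> \<le> S \<longrightarrow> \<bar>G r z\<bar> \<le> M * r" by blast
  qed
  finally show ?thesis .
qed

section \<open>The energy identity\<close>

text \<open>
  By the mean value theorem the majorant of the derivative near \<open>t\<close> also bounds the difference
  quotients, so dominated convergence applies along every sequence tending to \<open>t\<close>.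
\<close>

lemma has_derivative_integral_dominated:
  fixes f f' :: "real \<Rightarrow> 'a \<Rightarrow> real"
  assumes "open I" "t \<in> I" "\<delta> > 0"
    and int: "\<And>s. s \<in> I \<Longrightarrow> integrable M (f s)"
    and deriv: "\<And>s x. s \<in> I \<Longrightarrow> x \<in> space M \<Longrightarrow> ((\<lambda>s. f s x) has_real_derivative f' s x) (at s)"
    and h: "integrable M h"
    and bound: "\<And>s x. s \<in> I \<Longrightarrow> \<bar>s - t\<bar> < \<delta> \<Longrightarrow> x \<in> space M \<Longrightarrow> \<bar>f' s x\<bar> \<le> h x"
    and meas: "f' t \<in> borel_measurable M"
  shows "((\<lambda>s. \<integral>x. f s x \<partial>M) has_real_derivative (\<integral>x. f' t x \<partial>M)) (at t)"
    and "integrable M (f' t)"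
proof -
  show "integrable M (f' t)"
    using h meas by (rule Bochner_Integration.integrable_bound) (use bound[of t] assms(1-3) in \<open>force intro!: AE_I2\<close>)
  obtain d where "d > 0" and d: "ball t d \<subseteq> I"
    using assms(1,2) by (meson open_contains_ball)
  define \<rho> where "\<rho> = min d \<delta>"
  have "\<rho> > 0" using \<open>d > 0\<close> \<open>\<delta> > 0\<close> by (simp add: \<rho>_def)
  have near: "s \<in> I" "\<bar>s - t\<bar> < \<delta>" if "\<bar>s - t\<bar> < \<rho>" for s
    using that d by (auto simp: \<rho>_def dist_real_def abs_minus_commute)
  have quotient: "\<bar>(f s x - f t x) / (s - t)\<bar> \<le> h x" if s: "\<bar>s - t\<bar> < \<rho>" "s \<noteq> t" and x: "x \<in> space M" for s x
  proof -
    have "\<exists>\<xi>. \<bar>\<xi> - t\<bar> < \<rho> \<and> f s x - f t x = (s - t) * f' \<xi> x"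
    proof (cases "t < s")
      case True
      then obtain \<xi> where "t < \<xi>" "\<xi> < s" "f s x - f t x = (s - t) * f' \<xi> x"
        using MVT2[of t s "\<lambda>s. f s x" "\<lambda>s. f' s x"] deriv near x s by force
      then show ?thesis using s True by (intro exI[of _ \<xi>]) auto
    next
      case False
      then have "s < t" using s by simp
      then obtain \<xi> where "s < \<xi>" "\<xi> < t" "f t x - f s x = (t - s) * f' \<xi> x"
        using MVT2[of s t "\<lambda>s. f s x" "\<lambda>s. f' s x"] deriv near x s by force
      then show ?thesis using s \<open>s < t\<close> by (intro exI[of _ \<xi>]) (auto simp: algebra_simps)
    qed
    then obtain \<xi> where "\<bar>\<xi> - t\<bar> < \<rho>" "f s x - f t x = (s - t) * f' \<xi> x" by blast
    then show ?thesis using bound[OF near x] s by simp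
  qed
  show "((\<lambda>s. \<integral>x. f s x \<partial>M) has_real_derivative (\<integral>x. f' t x \<partial>M)) (at t)"
    unfolding has_field_derivative_iff tendsto_at_iff_sequentially
  proof (intro allI impI)
    fix X :: "nat \<Rightarrow> real"
    assume "\<forall>i. X i \<in> UNIV - {t}" and X: "X \<longlonglongrightarrow> t"
    then have Xt: "X i \<noteq> t" for i by auto
    obtain N where N: "\<And>n. n \<ge> N \<Longrightarrow> \<bar>X n - t\<bar> < \<rho>"
      using LIMSEQ_D[OF X \<open>\<rho> > 0\<close>] by auto
    let ?q = "\<lambda>n x. (f (X (n + N)) x - f t x) / (X (n + N) - t)"
    have conv: "(\<lambda>n. \<integral>x. ?q n x \<partial>M) \<longlonglongrightarrow> (\<integral>x. f' t x \<partial>M)"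
    proof (rule integral_dominated_convergence[OF meas _ h])
      show "?q n \<in> borel_measurable M" for n
        using int[OF near(1)[OF N]] int[OF \<open>t \<in> I\<close>] by (auto intro!: borel_measurable_divide borel_measurable_diff)
      show "AE x in M. norm (?q n x) \<le> h x" for n
        using quotient N Xt by (auto intro!: AE_I2)
      show "AE x in M. (\<lambda>n. ?q n x) \<longlonglongrightarrow> f' t x"
      proof (rule AE_I2)
        fix x assume "x \<in> space M"
        then have "((\<lambda>s. (f s x - f t x) / (s - t)) \<longlongrightarrow> f' t x) (at t)"
          using deriv[OF \<open>t \<in> I\<close>] by (simp add: has_field_derivative_iff)
        moreover have "filterlim (\<lambda>n. X (n + N)) (at t) sequentially"
          using LIMSEQ_ignore_initial_segment[OF X] Xt by (auto simp: filterlim_at)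
        ultimately show "(\<lambda>n. ?q n x) \<longlonglongrightarrow> f' t x"
          by (rule filterlim_compose)
      qed
    qed
    let ?Q = "(\<lambda>s. ((\<integral>x. f s x \<partial>M) - (\<integral>x. f t x \<partial>M)) / (s - t)) \<circ> X"
    have "(\<lambda>n. \<integral>x. ?q n x \<partial>M) = (\<lambda>n. ?Q (n + N))"
    proof
      fix n
      show "(\<integral>x. ?q n x \<partial>M) = ?Q (n + N)"
        using int[OF near(1)[OF N, of "n + N"]] int[OF \<open>t \<in> I\<close>] by simp
    qed
    from conv[unfolded this] show "?Q \<longlonglongrightarrow> (\<integral>x. f' t x \<partial>M)"
      by (rule LIMSEQ_offset)
  qed
qed

lemma L2norm_power2: "(L2norm f)\<^sup>2 = (\<integral>(r, z). (norm (f r z))\<^sup>2 \<partial>mu5)"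
  unfolding L2norm_def by (simp add: integral_nonneg split_beta')

lemma norm_grad_power2: "(norm (grad f r z))\<^sup>2 = (pd_r f r z)\<^sup>2 + (pd_z f r z)\<^sup>2"
  by (simp add: grad_def norm_Pair)

text \<open>
  The energy balance at a fixed time, \<open>ft\<close> being the time derivative: integrate the field \<open>\<Phi>\<close> of the
  introduction.  In its \<open>z\<close>-component the part $-2wf^2$ of $-\frac12f^2\,b_4[w]$ cancels $2wf^2$, which
  is why \<open>Q\<close> below contains no such term.
\<close>

lemma energy_identity:
  fixes f w ft :: "real \<Rightarrow> real \<Rightarrow> real"
  assumes f: "smooth_up_to_axis f" and w: "smooth_up_to_axis w"
    and poisson: "\<And>r z. r > 0 \<Longrightarrow> lap5 w r z = pd_z (\<lambda>r z. (f r z)\<^sup>2) r z"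
    and transport: "\<And>r z. r > 0 \<Longrightarrow>
      ft r z + b4 w r z \<bullet> grad f r z = \<nu> * lap5 f r z + 2 * pd_z w r z * f r z"
    and L2: "in_L2 f" "in_L2 (grad f)" "in_L2 (grad w)"
    and fluxes: "integrable_fluxes f w"
    and w_bounded: "\<And>r z. r > 0 \<Longrightarrow> \<bar>w r z\<bar> \<le> B"
    and int_ft: "integrable mu5 (\<lambda>(r, z). f r z * ft r z)"
  shows "(\<integral>(r, z). f r z * ft r z \<partial>mu5) + \<nu> * (L2norm (grad f))\<^sup>2 = 2 * (L2norm (grad w))\<^sup>2"
proof -
  note fr = smooth_up_to_axis_pd_r[OF f] and fz = smooth_up_to_axis_pd_z[OF f]
  note wr = smooth_up_to_axis_pd_r[OF w] and wz = smooth_up_to_axis_pd_z[OF w]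
  note frr = smooth_up_to_axis_pd_r[OF fr] and fzz = smooth_up_to_axis_pd_z[OF fz]
  note wrr = smooth_up_to_axis_pd_r[OF wr] and wzz = smooth_up_to_axis_pd_z[OF wz]
    and wrz = smooth_up_to_axis_pd_z[OF wr]
  note smooth_all = f w fr fz wr wz frr fzz wrr wzz wrz
  note cont = smooth_all[THEN smooth_up_to_axis_continuous_on, unfolded split_beta']
  define P Q Pr Qz where
    "P = (\<lambda>r z. 1 / 2 * r * (f r z)\<^sup>2 * pd_z w r z + \<nu> * f r z * pd_r f r z - 2 * w r z * pd_r w r z)" and
    "Q = (\<lambda>r z. \<nu> * f r z * pd_z f r z - 1 / 2 * r * (f r z)\<^sup>2 * pd_r w r z - 2 * w r z * pd_z w r z)" and
    "Pr = (\<lambda>r z. 1 / 2 * (f r z)\<^sup>2 * pd_z w r z + r * f r z * pd_r f r z * pd_z w r z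
        + 1 / 2 * r * (f r z)\<^sup>2 * pd_z (pd_r w) r z + \<nu> * ((pd_r f r z)\<^sup>2 + f r z * pd_r (pd_r f) r z)
        - 2 * ((pd_r w r z)\<^sup>2 + w r z * pd_r (pd_r w) r z))" and
    "Qz = (\<lambda>r z. \<nu> * ((pd_z f r z)\<^sup>2 + f r z * pd_z (pd_z f) r z) - r * f r z * pd_z f r z * pd_r w r z
        - 1 / 2 * r * (f r z)\<^sup>2 * pd_z (pd_r w) r z - 2 * ((pd_z w r z)\<^sup>2 + w r z * pd_z (pd_z w) r z))"
  \<comment> \<open>The mixed derivative of \<open>w\<close> cancels between \<open>Pr\<close> and \<open>Qz\<close>; this is \<open>b4 w\<close> being divergence free.\<close>
  have divergence: "Pr r z + 3 / r * P r z + Qz r z =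
      f r z * ft r z + \<nu> * (norm (grad f r z))\<^sup>2 - 2 * (norm (grad w r z))\<^sup>2" if "r > 0" for r z
  proof -
    have lap_w: "lap5 w r z = 2 * f r z * pd_z f r z"
      using poisson[OF that] pd_z_square[OF f that] by simp
    have ft: "ft r z = \<nu> * lap5 f r z + 2 * pd_z w r z * f r z
        + r * pd_z w r z * pd_r f r z - (4 * w r z + r * pd_r w r z) * pd_z f r z"
      using transport[OF that, of z] by (simp add: b4_def grad_def algebra_simps)
    have "Pr r z + 3 / r * P r z + Qz r z = 2 * (f r z)\<^sup>2 * pd_z w r z
        + r * f r z * (pd_r f r z * pd_z w r z - pd_z f r z * pd_r w r z)
        + \<nu> * ((pd_r f r z)\<^sup>2 + (pd_z f r z)\<^sup>2 + f r z * lap5 f r z)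
        - 2 * ((pd_r w r z)\<^sup>2 + (pd_z w r z)\<^sup>2 + w r z * lap5 w r z)"
      using that unfolding Pr_def P_def Qz_def lap5_def by (simp add: field_simps)
    then show ?thesis
      unfolding norm_grad_power2 lap_w ft by (simp add: algebra_simps power2_eq_square)
  qed
  have contP: "continuous_on half_plane (\<lambda>(r, z). P r z)" and contQ: "continuous_on half_plane (\<lambda>(r, z). Q r z)"
    and contPr: "continuous_on half_plane (\<lambda>(r, z). Pr r z)" and contQz: "continuous_on half_plane (\<lambda>(r, z). Qz r z)"
    unfolding P_def Q_def Pr_def Qz_def split_beta' by (intro continuous_intros cont)+
  have f2: "integrable mu5 (\<lambda>(r, z). (f r z)\<^sup>2)"
    and gf2: "integrable mu5 (\<lambda>(r, z). (norm (grad f r z))\<^sup>2)"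
    and gw2: "integrable mu5 (\<lambda>(r, z). (norm (grad w r z))\<^sup>2)"
    using L2 by (simp_all add: in_L2_def)
  \<comment> \<open>For either component \<open>g\<close> of the gradient, since \<open>\<bar>f g\<bar>\<close> is at most the sum of the squares.\<close>
  have dominated: "integrable mu5 (\<lambda>(r, z). f r z * g r z)"
    if g: "smooth_up_to_axis g" "\<And>r z. (g r z)\<^sup>2 \<le> (norm (grad f r z))\<^sup>2" for g
  proof (rule Bochner_Integration.integrable_bound[OF Bochner_Integration.integrable_add[OF f2 gf2]])
    show "(\<lambda>(r, z). f r z * g r z) \<in> borel_measurable mu5"
      unfolding split_beta'
      by (intro continuous_on_imp_measurable_mu5 continuous_intros cont
          smooth_up_to_axis_continuous_on[OF g(1), unfolded split_beta'])
    have "\<bar>f r z * g r z\<bar> \<le> (f r z)\<^sup>2 + (norm (grad f r z))\<^sup>2" for r z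
    proof -
      have "2 * \<bar>f r z * g r z\<bar> \<le> (f r z)\<^sup>2 + (g r z)\<^sup>2"
        using sum_squares_bound[of "\<bar>f r z\<bar>" "\<bar>g r z\<bar>"] by (simp add: abs_mult)
      then show ?thesis using g(2)[of r z] by simp
    qed
    then show "AE p in mu5. norm ((\<lambda>(r, z). f r z * g r z) p)
        \<le> norm ((\<lambda>(r, z). (f r z)\<^sup>2) p + (\<lambda>(r, z). (norm (grad f r z))\<^sup>2) p)"
      by (intro AE_I2) (auto simp: split_beta')
  qed
  have ffr: "integrable mu5 (\<lambda>(r, z). f r z * pd_r f r z)" and ffz: "integrable mu5 (\<lambda>(r, z). f r z * pd_z f r z)"
    by (intro dominated fr fz; simp add: norm_grad_power2)+
  have wf2: "integrable mu5 (\<lambda>(r, z). w r z * (f r z)\<^sup>2)"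
  proof (rule Bochner_Integration.integrable_bound[OF Bochner_Integration.integrable_mult_right[OF f2, of B]])
    show "(\<lambda>(r, z). w r z * (f r z)\<^sup>2) \<in> borel_measurable mu5"
      unfolding split_beta' by (intro continuous_on_imp_measurable_mu5 continuous_intros cont)
    have "\<bar>w r z * (f r z)\<^sup>2\<bar> \<le> \<bar>B * (f r z)\<^sup>2\<bar>" if "r > 0" for r z
      using w_bounded[OF that, of z] by (simp add: abs_mult mult_right_mono)
    then show "AE p in mu5. norm ((\<lambda>(r, z). w r z * (f r z)\<^sup>2) p) \<le> norm (B * (\<lambda>(r, z). (f r z)\<^sup>2) p)"
      by (intro AE_I2) (auto simp: space_mu5)
  qed
  have b: "integrable mu5 (\<lambda>p. (f (fst p) (snd p))\<^sup>2 *\<^sub>R b4 w (fst p) (snd p))"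
    and wgw: "integrable mu5 (\<lambda>p. w (fst p) (snd p) *\<^sub>R grad w (fst p) (snd p))"
    using fluxes by (simp_all add: integrable_fluxes_def split_beta')
  have intP: "integrable mu5 (\<lambda>(r, z). P r z)"
  proof -
    have "integrable mu5 (\<lambda>p. - (1 / 2) * fst ((f (fst p) (snd p))\<^sup>2 *\<^sub>R b4 w (fst p) (snd p))
        + \<nu> * (\<lambda>(r, z). f r z * pd_r f r z) p - 2 * fst (w (fst p) (snd p) *\<^sub>R grad w (fst p) (snd p)))"
      by (intro Bochner_Integration.integrable_add Bochner_Integration.integrable_diff
          integrable_mult_right integrable_fst b wgw ffr)
    then show ?thesis
      by (rule Bochner_Integration.integrable_cong[THEN iffD1, rotated -1])
        (auto simp: P_def b4_def grad_def algebra_simps)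
  qed
  \<comment> \<open>Adding \<open>2 w f\<^sup>2\<close>, integrable as \<open>w\<close> is bounded, removes the term \<open>4 w\<close> of \<open>b4 w\<close>.\<close>
  have intQ: "integrable mu5 (\<lambda>(r, z). Q r z)"
  proof -
    have "integrable mu5 (\<lambda>p. - (1 / 2) * snd ((f (fst p) (snd p))\<^sup>2 *\<^sub>R b4 w (fst p) (snd p))
        + \<nu> * (\<lambda>(r, z). f r z * pd_z f r z) p + 2 * (\<lambda>(r, z). w r z * (f r z)\<^sup>2) p
        - 2 * snd (w (fst p) (snd p) *\<^sub>R grad w (fst p) (snd p)))"
      by (intro Bochner_Integration.integrable_add Bochner_Integration.integrable_diff
          integrable_mult_right integrable_snd b wgw ffz wf2)
    then show ?thesis
      by (rule Bochner_Integration.integrable_cong[THEN iffD1, rotated -1])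
        (auto simp: Q_def b4_def grad_def algebra_simps)
  qed
  let ?R = "\<lambda>p. (\<lambda>(r, z). f r z * ft r z) p + \<nu> * (\<lambda>(r, z). (norm (grad f r z))\<^sup>2) p
      - 2 * (\<lambda>(r, z). (norm (grad w r z))\<^sup>2) p"
  have intR: "integrable mu5 ?R"
    by (intro Bochner_Integration.integrable_add Bochner_Integration.integrable_diff
        integrable_mult_right int_ft gf2 gw2)
  have eqR: "(\<lambda>(r, z). Pr r z + 3 / r * P r z + Qz r z) p = ?R p" if "p \<in> space mu5" for p
    using that divergence by (auto simp: space_mu5)
  have axis: "\<exists>M>0. \<forall>r z. 0 < r \<and> r \<le> 1 \<and> \<bar>z\<bar> \<le> S \<longrightarrow> \<bar>P r z\<bar> \<le> M" for S
  proof -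
    obtain Mf where Mf: "Mf > 0" "\<And>r z. 0 < r \<Longrightarrow> r \<le> 1 \<Longrightarrow> \<bar>z\<bar> \<le> S \<Longrightarrow> \<bar>f r z\<bar> \<le> Mf"
      using smooth_up_to_axis_bounded[OF f, of 1 S] by blast
    obtain Mw where Mw: "Mw > 0" "\<And>r z. 0 < r \<Longrightarrow> r \<le> 1 \<Longrightarrow> \<bar>z\<bar> \<le> S \<Longrightarrow> \<bar>w r z\<bar> \<le> Mw"
      using smooth_up_to_axis_bounded[OF w, of 1 S] by blast
    obtain Mfr where Mfr: "Mfr > 0" "\<And>r z. 0 < r \<Longrightarrow> r \<le> 1 \<Longrightarrow> \<bar>z\<bar> \<le> S \<Longrightarrow> \<bar>pd_r f r z\<bar> \<le> Mfr"
      using smooth_up_to_axis_bounded[OF fr, of 1 S] by blast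
    obtain Mwr where Mwr: "Mwr > 0" "\<And>r z. 0 < r \<Longrightarrow> r \<le> 1 \<Longrightarrow> \<bar>z\<bar> \<le> S \<Longrightarrow> \<bar>pd_r w r z\<bar> \<le> Mwr"
      using smooth_up_to_axis_bounded[OF wr, of 1 S] by blast
    obtain Mwz where Mwz: "Mwz > 0" "\<And>r z. 0 < r \<Longrightarrow> r \<le> 1 \<Longrightarrow> \<bar>z\<bar> \<le> S \<Longrightarrow> \<bar>pd_z w r z\<bar> \<le> Mwz"
      using smooth_up_to_axis_bounded[OF wz, of 1 S] by blast
    note pos = Mf(1) Mw(1) Mfr(1) Mwr(1) Mwz(1) and M = Mf(2) Mw(2) Mfr(2) Mwr(2) Mwz(2)
    have "\<bar>P r z\<bar> \<le> 1 / 2 * 1 * Mf\<^sup>2 * Mwz + \<bar>\<nu>\<bar> * Mf * Mfr + 2 * Mw * Mwr"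
      if "0 < r" "r \<le> 1" "\<bar>z\<bar> \<le> S" for r z
    proof -
      have "\<bar>P r z\<bar> \<le> \<bar>1 / 2 * r * (f r z)\<^sup>2 * pd_z w r z\<bar> + \<bar>\<nu> * f r z * pd_r f r z\<bar> + \<bar>2 * w r z * pd_r w r z\<bar>"
        unfolding P_def by linarith
      also have "\<dots> = 1 / 2 * r * \<bar>f r z\<bar>\<^sup>2 * \<bar>pd_z w r z\<bar> + \<bar>\<nu>\<bar> * \<bar>f r z\<bar> * \<bar>pd_r f r z\<bar> + 2 * \<bar>w r z\<bar> * \<bar>pd_r w r z\<bar>"
        using that by (simp add: abs_mult)
      also have "\<dots> \<le> 1 / 2 * 1 * Mf\<^sup>2 * Mwz + \<bar>\<nu>\<bar> * Mf * Mfr + 2 * Mw * Mwr"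
        using that M pos by (intro add_mono mult_mono power_mono mult_nonneg_nonneg) auto
      finally show ?thesis .
    qed
    moreover have "1 / 2 * 1 * Mf\<^sup>2 * Mwz + \<bar>\<nu>\<bar> * Mf * Mfr + 2 * Mw * Mwr > 0"
      using pos by (intro add_nonneg_pos add_nonneg_nonneg) auto
    ultimately show ?thesis by blast
  qed
  have "(\<integral>(r, z). Pr r z + 3 / r * P r z + Qz r z \<partial>mu5) = 0"
  proof (rule integral_div5_eq_0[OF _ _ contP contQ contPr contQz intP intQ _ axis])
    fix r z :: real assume "r > 0"
    note D = DERIV_pd_r[OF f \<open>r > 0\<close>] DERIV_pd_r[OF w \<open>r > 0\<close>] DERIV_pd_r[OF fr \<open>r > 0\<close>]
      DERIV_pd_r[OF wr \<open>r > 0\<close>] DERIV_pd_r[OF wz \<open>r > 0\<close>, unfolded pd_r_pd_z_commute[OF w \<open>r > 0\<close>]]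
    show "((\<lambda>s. P s z) has_real_derivative Pr r z) (at r)"
      unfolding P_def Pr_def by (rule derivative_eq_intros refl D)+ (simp add: algebra_simps power2_eq_square)
    note D = DERIV_pd_z[OF f \<open>r > 0\<close>] DERIV_pd_z[OF w \<open>r > 0\<close>] DERIV_pd_z[OF fz \<open>r > 0\<close>]
      DERIV_pd_z[OF wr \<open>r > 0\<close>] DERIV_pd_z[OF wz \<open>r > 0\<close>]
    show "((\<lambda>s. Q r s) has_real_derivative Qz r z) (at z)"
      unfolding Q_def Qz_def by (rule derivative_eq_intros refl D)+ (simp add: algebra_simps power2_eq_square)
  next
    show "integrable mu5 (\<lambda>(r, z). Pr r z + 3 / r * P r z + Qz r z)"
      using intR by (rule Bochner_Integration.integrable_cong[THEN iffD2, rotated -1]) (use eqR in auto)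
  qed
  also have "(\<integral>(r, z). Pr r z + 3 / r * P r z + Qz r z \<partial>mu5) = (\<integral>p. ?R p \<partial>mu5)"
    using eqR by (rule Bochner_Integration.integral_cong[OF refl])
  also have "\<dots> = (\<integral>(r, z). f r z * ft r z \<partial>mu5) + \<nu> * (\<integral>(r, z). (norm (grad f r z))\<^sup>2 \<partial>mu5)
      - 2 * (\<integral>(r, z). (norm (grad w r z))\<^sup>2 \<partial>mu5)"
    using int_ft gf2 gw2 by simp
  finally show ?thesis by (simp add: L2norm_power2)
qed

section \<open>Uniqueness for the Poisson equation\<close>

lemma vanishes_at_infinity_iff:
  "vanishes_at_infinity f \<longleftrightarrow> (\<forall>e>0. \<exists>R. \<forall>r>0. \<forall>z. R \<le> norm (r, z) \<longrightarrow> \<bar>f r z\<bar> < e)"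
  unfolding vanishes_at_infinity_def tendsto_iff eventually_inf_principal eventually_at_infinity
  by (fastforce simp: dist_real_def)

lemma vanishes_at_infinity_imp_bounded:
  assumes "smooth_up_to_axis f" "vanishes_at_infinity f"
  shows "\<exists>B. \<forall>r>0. \<forall>z. \<bar>f r z\<bar> \<le> B"
proof -
  obtain R where R: "\<And>r z. r > 0 \<Longrightarrow> R \<le> norm (r, z) \<Longrightarrow> \<bar>f r z\<bar> < 1"
    using assms(2) unfolding vanishes_at_infinity_iff by (meson zero_less_one)
  obtain M where M: "M > 0" "\<And>r z. 0 < r \<Longrightarrow> r \<le> R \<Longrightarrow> \<bar>z\<bar> \<le> R \<Longrightarrow> \<bar>f r z\<bar> \<le> M"
    using smooth_up_to_axis_bounded[OF assms(1), of R R] by blast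
  have "\<bar>f r z\<bar> \<le> max 1 M" if "r > 0" for r z
  proof (cases "R \<le> norm (r, z)")
    case True
    then show ?thesis using R[OF that] by (smt (verit))
  next
    case False
    then have "r \<le> R" "\<bar>z\<bar> \<le> R"
      using norm_fst_le[of r z] norm_snd_le[of z r] that by auto
    then show ?thesis using M(2)[OF that] by fastforce
  qed
  then show ?thesis by blast
qed

lemma second_derivative_at_local_max:
  fixes f f' :: "real \<Rightarrow> real"
  assumes "d > 0"
    and f: "\<And>s. \<bar>s - x\<bar> < d \<Longrightarrow> (f has_real_derivative f' s) (at s)"
    and f': "(f' has_real_derivative D) (at x)"
    and max: "\<And>s. \<bar>s - x\<bar> < d \<Longrightarrow> f s \<le> f x"
  shows "f' x = 0 \<and> D \<le> 0"
proof
  show 0: "f' x = 0"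
    using DERIV_local_max[OF f[of x] \<open>d > 0\<close>] max \<open>d > 0\<close> by (auto simp: abs_minus_commute)
  show "D \<le> 0"
  proof (rule ccontr)
    assume "\<not> D \<le> 0"
    then obtain e where e: "e > 0" "\<And>h. h > 0 \<Longrightarrow> h < e \<Longrightarrow> f' x < f' (x + h)"
      using DERIV_pos_inc_right[OF f'] by auto
    define s where "s = x + min d e / 2"
    have s: "x < s" "s - x < d" "s - x < e" using \<open>d > 0\<close> \<open>e > 0\<close> by (auto simp: s_def min_def)
    obtain \<xi> where \<xi>: "x < \<xi>" "\<xi> < s" "f s - f x = (s - x) * f' \<xi>"
      using MVT2[of x s f f'] f s by auto
    have "f' \<xi> > 0" using e(2)[of "\<xi> - x"] \<xi> s 0 by simp
    then have "f s - f x > 0" unfolding \<xi>(3) using s(1) by simp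
    with max[of s] s show False by simp
  qed
qed

lemma DERIV_inverse_power:
  assumes "(s::real) \<noteq> 0"
  shows "((\<lambda>s. 1 / s ^ n) has_real_derivative - real n / s ^ Suc n) (at s)"
proof (cases n)
  case (Suc m)
  have "((\<lambda>s. 1 / s ^ n) has_real_derivative (0 * s ^ n - 1 * (real n * s ^ (n - Suc 0))) / (s ^ n * s ^ n)) (at s)"
    by (rule derivative_eq_intros refl)+ (use assms in auto)
  moreover have "(0 * s ^ n - 1 * (real n * s ^ (n - Suc 0))) / (s ^ n * s ^ n) = - real n / s ^ Suc n"
    using assms by (simp add: Suc frac_eq_eq algebra_simps)
  ultimately show ?thesis by simp
qed simp

text \<open>
  Maximum principle on the open half-plane.  If \<open>u\<close> had a positive value \<open>M\<close> at \<open>(r\<^sub>0, z\<^sub>0)\<close>, then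
  for small \<open>\<epsilon>\<close> the function $v=u+\epsilon(r^2+z^2-r^{-2})$ would be larger there than on the
  boundary of the region \<open>r \<ge> \<rho>\<close>, \<open>norm (r, z) \<le> R\<close>: on the arc because \<open>u\<close> is small far away, on
  the segment \<open>r = \<rho>\<close> because $r^{-2}$ beats the bound \<open>B\<close>.  So \<open>v\<close> has an interior maximum, where
  its Laplacian is at most zero; but $\Delta_5(r^2+z^2)=10$ and $\Delta_5r^{-2}=0$.
\<close>

lemma subharmonic5_nonpos:
  fixes u ur urr uz uzz :: "real \<Rightarrow> real \<Rightarrow> real"
  assumes ur: "\<And>r z. r > 0 \<Longrightarrow> ((\<lambda>s. u s z) has_real_derivative ur r z) (at r)"
    and urr: "\<And>r z. r > 0 \<Longrightarrow> ((\<lambda>s. ur s z) has_real_derivative urr r z) (at r)"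
    and uz: "\<And>r z. r > 0 \<Longrightarrow> ((\<lambda>s. u r s) has_real_derivative uz r z) (at z)"
    and uzz: "\<And>r z. r > 0 \<Longrightarrow> ((\<lambda>s. uz r s) has_real_derivative uzz r z) (at z)"
    and cont: "continuous_on half_plane (\<lambda>(r, z). u r z)"
    and bounded: "\<And>r z. r > 0 \<Longrightarrow> \<bar>u r z\<bar> \<le> B"
    and decay: "vanishes_at_infinity u"
    and subharmonic: "\<And>r z. r > 0 \<Longrightarrow> 0 \<le> urr r z + 3 / r * ur r z + uzz r z"
    and "r\<^sub>0 > 0"
  shows "u r\<^sub>0 z\<^sub>0 \<le> 0"
proof (rule ccontr)
  assume pos: "\<not> ?thesis"
  define M where "M = u r\<^sub>0 z\<^sub>0"
  have "M > 0" using pos by (simp add: M_def)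
  have "B > 0" using bounded[OF \<open>r\<^sub>0 > 0\<close>, of z\<^sub>0] \<open>M > 0\<close> by (simp add: M_def)
  obtain R\<^sub>0 where R\<^sub>0: "\<And>r z. r > 0 \<Longrightarrow> R\<^sub>0 \<le> norm (r, z) \<Longrightarrow> \<bar>u r z\<bar> < M / 4"
    using decay \<open>M > 0\<close> unfolding vanishes_at_infinity_iff by (meson divide_pos_pos zero_less_numeral)
  define R where "R = max R\<^sub>0 (norm (r\<^sub>0, z\<^sub>0)) + 1"
  have "R > 0" unfolding R_def by (smt (verit) norm_ge_zero)
  define \<epsilon> where "\<epsilon> = min (M / (4 * R\<^sup>2)) (M * r\<^sub>0\<^sup>2 / 4)"
  have \<epsilon>: "\<epsilon> > 0" "\<epsilon> * R\<^sup>2 \<le> M / 4" "\<epsilon> / r\<^sub>0\<^sup>2 \<le> M / 4"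
  proof -
    show "\<epsilon> > 0" using \<open>M > 0\<close> \<open>R > 0\<close> \<open>r\<^sub>0 > 0\<close> by (simp add: \<epsilon>_def)
    have "\<epsilon> \<le> M / (4 * R\<^sup>2)" "\<epsilon> \<le> M * r\<^sub>0\<^sup>2 / 4" by (simp_all add: \<epsilon>_def)
    then show "\<epsilon> * R\<^sup>2 \<le> M / 4" "\<epsilon> / r\<^sub>0\<^sup>2 \<le> M / 4"
      using \<open>R > 0\<close> \<open>r\<^sub>0 > 0\<close> by (simp_all add: field_simps)
  qed
  \<comment> \<open>At this distance from the axis \<open>\<epsilon> / \<rho>\<^sup>2\<close> is at least the bound of \<open>u\<close>.\<close>
  define \<rho> where "\<rho> = min (r\<^sub>0 / 2) (sqrt (\<epsilon> / B))"
  have \<rho>: "\<rho> > 0" "\<rho> < r\<^sub>0" "B \<le> \<epsilon> / \<rho>\<^sup>2"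
  proof -
    show "\<rho> > 0" "\<rho> < r\<^sub>0" using \<open>r\<^sub>0 > 0\<close> \<open>\<epsilon> > 0\<close> \<open>B > 0\<close> by (auto simp: \<rho>_def min_less_iff_disj)
    have "\<rho> \<le> sqrt (\<epsilon> / B)" by (simp add: \<rho>_def)
    then have "\<rho>\<^sup>2 \<le> \<epsilon> / B"
      using \<open>\<rho> > 0\<close> \<open>\<epsilon> > 0\<close> \<open>B > 0\<close> power_mono[of \<rho> "sqrt (\<epsilon> / B)" 2] by simp
    then show "B \<le> \<epsilon> / \<rho>\<^sup>2" using \<open>\<rho> > 0\<close> \<open>B > 0\<close> by (simp add: field_simps)
  qed
  define v where "v = (\<lambda>r z. u r z + \<epsilon> * (r\<^sup>2 + z\<^sup>2 - 1 / r\<^sup>2))"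
  define K where "K = cball 0 R \<inter> {p :: real \<times> real. \<rho> \<le> fst p}"
  have "compact K"
    unfolding K_def by (intro compact_Int_closed compact_cball closed_Collect_le continuous_intros)
  moreover have "(r\<^sub>0, z\<^sub>0) \<in> K"
    using \<rho> by (auto simp: K_def R_def)
  moreover have "continuous_on K (\<lambda>p. v (fst p) (snd p))"
  proof -
    have "K \<subseteq> half_plane" using \<rho>(1) by (auto simp: K_def)
    then have "continuous_on K (\<lambda>p. u (fst p) (snd p))"
      using continuous_on_subset[OF cont] by (simp add: split_beta')
    then show ?thesis unfolding v_def using \<open>K \<subseteq> half_plane\<close> by (auto intro!: continuous_intros)
  qed
  ultimately obtain p where p: "p \<in> K" "\<And>q. q \<in> K \<Longrightarrow> v (fst q) (snd q) \<le> v (fst p) (snd p)"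
    using continuous_attains_sup[of K "\<lambda>p. v (fst p) (snd p)"] by blast
  obtain r z where rz: "p = (r, z)" by (cases p)
  have "\<rho> \<le> r" "norm (r, z) \<le> R" using p(1) by (auto simp: K_def rz)
  have "r > 0" using \<open>\<rho> \<le> r\<close> \<rho>(1) by simp
  have "r\<^sup>2 + z\<^sup>2 = (norm (r, z))\<^sup>2" by (simp add: norm_Pair)
  also have "\<dots> \<le> R\<^sup>2" using \<open>norm (r, z) \<le> R\<close> by (simp add: power_mono)
  finally have "\<epsilon> * (r\<^sup>2 + z\<^sup>2) \<le> \<epsilon> * R\<^sup>2" using \<open>\<epsilon> > 0\<close> by simp
  then have v_le: "v r z \<le> u r z + M / 4 - \<epsilon> / r\<^sup>2"
    using \<epsilon>(2) by (simp add: v_def algebra_simps)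
  have "M - M / 4 \<le> v r\<^sub>0 z\<^sub>0"
  proof -
    have "v r\<^sub>0 z\<^sub>0 = M + \<epsilon> * (r\<^sub>0\<^sup>2 + z\<^sub>0\<^sup>2) - \<epsilon> / r\<^sub>0\<^sup>2" by (simp add: v_def M_def algebra_simps)
    moreover have "0 \<le> \<epsilon> * (r\<^sub>0\<^sup>2 + z\<^sub>0\<^sup>2)" using \<open>\<epsilon> > 0\<close> by simp
    ultimately show ?thesis using \<epsilon>(3) by linarith
  qed
  also have "\<dots> \<le> v r z" using p(2)[OF \<open>(r\<^sub>0, z\<^sub>0) \<in> K\<close>] by (simp add: rz)
  finally have v_ge: "M - M / 4 \<le> v r z" .
  have "\<rho> \<noteq> r"
  proof
    assume "\<rho> = r"
    then have "v r z \<le> M / 4" using v_le \<rho>(3) bounded[OF \<open>r > 0\<close>, of z] by simp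
    with v_ge \<open>M > 0\<close> show False by simp
  qed
  have "norm (r, z) \<noteq> R"
  proof
    assume "norm (r, z) = R"
    then have "\<bar>u r z\<bar> < M / 4" by (intro R\<^sub>0[OF \<open>r > 0\<close>]) (simp add: R_def)
    moreover have "0 \<le> \<epsilon> / r\<^sup>2" using \<open>\<epsilon> > 0\<close> by simp
    ultimately show False using v_le v_ge \<open>M > 0\<close> by linarith
  qed
  define U where "U = ball 0 R \<inter> {p :: real \<times> real. \<rho> < fst p}"
  have "open U" unfolding U_def by (intro open_Int open_ball open_Collect_less continuous_intros)
  moreover have "(r, z) \<in> U"
    using \<open>\<rho> \<noteq> r\<close> \<open>\<rho> \<le> r\<close> \<open>norm (r, z) \<noteq> R\<close> \<open>norm (r, z) \<le> R\<close> by (simp add: U_def)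
  ultimately obtain d where "d > 0" and d: "ball (r, z) d \<subseteq> U"
    by (meson open_contains_ball)
  have near: "v s y \<le> v r z \<and> s > 0" if "dist (r, z) (s, y) < d" for s y
  proof -
    have "(s, y) \<in> U" using d that by auto
    then have "(s, y) \<in> K" by (auto simp: U_def K_def)
    then show ?thesis using p(2)[of "(s, y)"] \<rho>(1) by (simp add: rz K_def)
  qed
  have dr: "dist (r, z) (s, z) < d" if "\<bar>s - r\<bar> < d" for s
    using that by (simp add: dist_Pair_Pair dist_real_def abs_minus_commute)
  have dz: "dist (r, z) (r, y) < d" if "\<bar>y - z\<bar> < d" for y
    using that by (simp add: dist_Pair_Pair dist_real_def abs_minus_commute)
  have r_test: "ur r z + \<epsilon> * (2 * r + 2 / r ^ 3) = 0 \<and> urr r z + \<epsilon> * (2 - 6 / r ^ 4) \<le> 0"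
  proof (rule second_derivative_at_local_max[where f = "\<lambda>s. v s z" and x = r
        and f' = "\<lambda>s. ur s z + \<epsilon> * (2 * s + 2 / s ^ 3)" and D = "urr r z + \<epsilon> * (2 - 6 / r ^ 4)", OF \<open>d > 0\<close>])
    fix s assume s: "\<bar>s - r\<bar> < d"
    then show "v s z \<le> v r z" using near dr by blast
    have "s > 0" using near dr s by blast
    show "((\<lambda>s. v s z) has_real_derivative ur s z + \<epsilon> * (2 * s + 2 / s ^ 3)) (at s)"
      unfolding v_def
      by (rule derivative_eq_intros refl ur DERIV_inverse_power \<open>s > 0\<close>)+
        (use \<open>s > 0\<close> in \<open>auto simp: power2_eq_square power3_eq_cube\<close>)
  next
    have "((\<lambda>s. ur s z + \<epsilon> * (2 * s + 2 * (1 / s ^ 3))) has_real_derivative urr r z + \<epsilon> * (2 - 6 / r ^ 4)) (at r)"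
      by (rule derivative_eq_intros refl urr DERIV_inverse_power \<open>r > 0\<close>)+ (use \<open>r > 0\<close> in \<open>auto simp: eval_nat_numeral\<close>)
    then show "((\<lambda>s. ur s z + \<epsilon> * (2 * s + 2 / s ^ 3)) has_real_derivative urr r z + \<epsilon> * (2 - 6 / r ^ 4)) (at r)"
      by simp
  qed
  have z_test: "uz r z + 2 * \<epsilon> * z = 0 \<and> uzz r z + 2 * \<epsilon> \<le> 0"
  proof (rule second_derivative_at_local_max[where f = "\<lambda>y. v r y" and x = z
        and f' = "\<lambda>y. uz r y + 2 * \<epsilon> * y", OF \<open>d > 0\<close>])
    fix y assume "\<bar>y - z\<bar> < d"
    then show "v r y \<le> v r z" using near dz by blast
    show "((\<lambda>y. v r y) has_real_derivative uz r y + 2 * \<epsilon> * y) (at y)"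
      unfolding v_def using \<open>r > 0\<close> by (auto intro!: derivative_eq_intros uz)
  next
    show "((\<lambda>y. uz r y + 2 * \<epsilon> * y) has_real_derivative uzz r z + 2 * \<epsilon>) (at z)"
      using \<open>r > 0\<close> by (auto intro!: derivative_eq_intros uzz)
  qed
  have ur_eq: "ur r z = - \<epsilon> * (2 * r + 2 / r ^ 3)" using r_test by simp
  have "urr r z + 3 / r * ur r z + uzz r z \<le> - \<epsilon> * (2 - 6 / r ^ 4) - 3 / r * (\<epsilon> * (2 * r + 2 / r ^ 3)) - 2 * \<epsilon>"
    using r_test z_test unfolding ur_eq by simp
  also have "\<dots> = - 10 * \<epsilon>" using \<open>r > 0\<close> by (simp add: field_simps eval_nat_numeral)
  finally show False using subharmonic[OF \<open>r > 0\<close>, of z] \<open>\<epsilon> > 0\<close> by simp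
qed

text \<open>
  The maximum principle applies to the difference, which is harmonic; exchanging the two solutions
  gives uniqueness.
\<close>

lemma decaying_poisson_solution_le:
  assumes V: "decaying_poisson_solution f V" and W: "decaying_poisson_solution f W" and "r > 0"
  shows "V r z \<le> W r z"
proof -
  have smV: "smooth_up_to_axis V" and smW: "smooth_up_to_axis W"
    using V W smooth5_imp_smooth_up_to_axis by (auto simp: decaying_poisson_solution_def)
  note Vr = smooth_up_to_axis_pd_r[OF smV] and Vz = smooth_up_to_axis_pd_z[OF smV]
  note Wr = smooth_up_to_axis_pd_r[OF smW] and Wz = smooth_up_to_axis_pd_z[OF smW]
  have vanish: "vanishes_at_infinity V" "vanishes_at_infinity W"
    using V W by (auto simp: decaying_poisson_solution_def)
  obtain BV where BV: "\<And>r z. r > 0 \<Longrightarrow> \<bar>V r z\<bar> \<le> BV"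
    using vanishes_at_infinity_imp_bounded[OF smV vanish(1)] by blast
  obtain BW where BW: "\<And>r z. r > 0 \<Longrightarrow> \<bar>W r z\<bar> \<le> BW"
    using vanishes_at_infinity_imp_bounded[OF smW vanish(2)] by blast
  have "V r z - W r z \<le> 0"
  proof (rule subharmonic5_nonpos[where u = "\<lambda>r z. V r z - W r z" and B = "BV + BW" and r\<^sub>0 = r and z\<^sub>0 = z])
    fix r z :: real assume "r > 0"
    show "((\<lambda>s. V s z - W s z) has_real_derivative pd_r V r z - pd_r W r z) (at r)"
      by (intro DERIV_diff DERIV_pd_r smV smW \<open>r > 0\<close>)
    show "((\<lambda>s. pd_r V s z - pd_r W s z) has_real_derivative pd_r (pd_r V) r z - pd_r (pd_r W) r z) (at r)"
      by (intro DERIV_diff DERIV_pd_r Vr Wr \<open>r > 0\<close>)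
    show "((\<lambda>s. V r s - W r s) has_real_derivative pd_z V r z - pd_z W r z) (at z)"
      by (intro DERIV_diff DERIV_pd_z smV smW \<open>r > 0\<close>)
    show "((\<lambda>s. pd_z V r s - pd_z W r s) has_real_derivative pd_z (pd_z V) r z - pd_z (pd_z W) r z) (at z)"
      by (intro DERIV_diff DERIV_pd_z Vz Wz \<open>r > 0\<close>)
    show "\<bar>V r z - W r z\<bar> \<le> BV + BW"
      using BV[OF \<open>r > 0\<close>, of z] BW[OF \<open>r > 0\<close>, of z] by linarith
    have "lap5 V r z = lap5 W r z"
      using V W \<open>r > 0\<close> by (simp add: decaying_poisson_solution_def)
    then show "0 \<le> pd_r (pd_r V) r z - pd_r (pd_r W) r z + 3 / r * (pd_r V r z - pd_r W r z)
        + (pd_z (pd_z V) r z - pd_z (pd_z W) r z)"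
      by (simp add: lap5_def algebra_simps)
  next
    show "continuous_on half_plane (\<lambda>(r, z). V r z - W r z)"
      unfolding split_beta'
      by (intro continuous_intros smV smW smooth_up_to_axis_continuous_on[unfolded split_beta'])
    show "vanishes_at_infinity (\<lambda>r z. V r z - W r z)"
      using tendsto_diff[OF vanish[unfolded vanishes_at_infinity_def]]
      by (simp add: vanishes_at_infinity_def split_beta')
  qed (rule \<open>r > 0\<close>)
  then show ?thesis by simp
qed

lemma decaying_poisson_solution_unique:
  assumes "decaying_poisson_solution f V" "decaying_poisson_solution f W" "r > 0"
  shows "V r z = W r z"
  using decaying_poisson_solution_le[OF assms, of z] decaying_poisson_solution_le[OF assms(2,1,3), of z] by simp

text \<open>
  Profiles are constrained only for \<open>r > 0\<close>; since that set is open, their derivatives there are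
  determined as well.
\<close>

lemma pd_cong_half_plane:
  assumes "\<And>r z. r > 0 \<Longrightarrow> f r z = g r z" "r > 0"
  shows "pd_r f r z = pd_r g r z" "pd_z f r z = pd_z g r z"
proof -
  have "\<forall>\<^sub>F s in nhds r. f s z = g s z"
    using eventually_nhds_in_open[of "{0<..}" r] assms by (auto elim!: eventually_mono)
  then show "pd_r f r z = pd_r g r z"
    unfolding pd_r_def by (rule deriv_cong_ev) simp
  show "pd_z f r z = pd_z g r z"
    unfolding pd_z_def using assms by (simp add: ext[of "f r" "g r"])
qed

lemma L2norm_grad_cong:
  assumes "\<And>r z. r > 0 \<Longrightarrow> f r z = g r z"
  shows "L2norm (grad f) = L2norm (grad g)"
  unfolding L2norm_def using pd_cong_half_plane[OF assms]
  by (auto intro!: arg_cong[where f = sqrt] Bochner_Integration.integral_cong simp: space_mu5 grad_def)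

section \<open>Dilations\<close>

lemma smooth5_dilate:
  assumes "smooth5 f" "l > 0"
  shows "smooth5 (\<lambda>r z. c * f (l * r) (l * z))"
proof -
  obtain g :: "(real ^ 4) \<times> real \<Rightarrow> real" where g: "smooth g" "\<And>x z. x \<noteq> 0 \<Longrightarrow> g (x, z) = f (norm x) z"
    using assms(1) unfolding smooth5_def by blast
  have "smooth (\<lambda>p. c * g (l *\<^sub>R p))"
    by (rule smooth_compose_linear[OF bounded_linear_scaleR_right g(1)])
  moreover have "c * g (l *\<^sub>R (x, z)) = c * f (l * norm x) (l * z)" if "x \<noteq> 0" for x z
    using g(2)[of "l *\<^sub>R x" "l * z"] that \<open>l > 0\<close> by simp
  ultimately show ?thesis unfolding smooth5_def by blast
qed

lemma pd_dilate:
  assumes "smooth_up_to_axis f" "l > 0" "r > 0"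
  shows "pd_r (\<lambda>r z. c * f (l * r) (l * z)) r z = c * l * pd_r f (l * r) (l * z)"
    and "pd_z (\<lambda>r z. c * f (l * r) (l * z)) r z = c * l * pd_z f (l * r) (l * z)"
proof -
  have lr: "l * r > 0" using assms by simp
  have scale: "((\<lambda>s. l * s) has_real_derivative l) (at x)" for x
    by (auto intro!: derivative_eq_intros)
  have "((\<lambda>s. c * f (l * s) (l * z)) has_real_derivative c * (pd_r f (l * r) (l * z) * l)) (at r)"
    by (intro DERIV_cmult DERIV_chain2[OF DERIV_pd_r[OF assms(1) lr] scale])
  then show "pd_r (\<lambda>r z. c * f (l * r) (l * z)) r z = c * l * pd_r f (l * r) (l * z)"
    unfolding pd_r_def[of "\<lambda>r z. c * f (l * r) (l * z)"] by (simp add: DERIV_imp_deriv mult_ac)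
  have "((\<lambda>s. c * f (l * r) (l * s)) has_real_derivative c * (pd_z f (l * r) (l * z) * l)) (at z)"
    by (intro DERIV_cmult DERIV_chain2[OF DERIV_pd_z[OF assms(1) lr] scale])
  then show "pd_z (\<lambda>r z. c * f (l * r) (l * z)) r z = c * l * pd_z f (l * r) (l * z)"
    unfolding pd_z_def[of "\<lambda>r z. c * f (l * r) (l * z)"] by (simp add: DERIV_imp_deriv mult_ac)
qed

lemma lap5_dilate:
  assumes "smooth_up_to_axis f" "l > 0" "r > 0"
  shows "lap5 (\<lambda>r z. c * f (l * r) (l * z)) r z = c * l\<^sup>2 * lap5 f (l * r) (l * z)"
proof -
  let ?g = "\<lambda>r z. c * f (l * r) (l * z)"
  have "pd_r (pd_r ?g) r z = pd_r (\<lambda>r z. (c * l) * pd_r f (l * r) (l * z)) r z"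
    by (rule pd_cong_half_plane) (use assms pd_dilate in auto)
  also have "\<dots> = c * l * l * pd_r (pd_r f) (l * r) (l * z)"
    by (rule pd_dilate[OF smooth_up_to_axis_pd_r[OF assms(1)] assms(2,3)])
  finally have rr: "pd_r (pd_r ?g) r z = c * l * l * pd_r (pd_r f) (l * r) (l * z)" .
  have "pd_z (pd_z ?g) r z = pd_z (\<lambda>r z. (c * l) * pd_z f (l * r) (l * z)) r z"
    by (rule pd_cong_half_plane) (use assms pd_dilate in auto)
  also have "\<dots> = c * l * l * pd_z (pd_z f) (l * r) (l * z)"
    by (rule pd_dilate[OF smooth_up_to_axis_pd_z[OF assms(1)] assms(2,3)])
  finally have zz: "pd_z (pd_z ?g) r z = c * l * l * pd_z (pd_z f) (l * r) (l * z)" .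
  show ?thesis
    unfolding lap5_def rr zz pd_dilate[OF assms] using assms(2,3)
    by (simp add: field_simps power2_eq_square)
qed

lemma vanishes_at_infinity_dilate:
  assumes "vanishes_at_infinity f" "l > 0" "c > 0"
  shows "vanishes_at_infinity (\<lambda>r z. c * f (l * r) (l * z))"
  unfolding vanishes_at_infinity_iff
proof (intro allI impI)
  fix e :: real assume "e > 0"
  then obtain R where R: "\<And>r z. r > 0 \<Longrightarrow> R \<le> norm (r, z) \<Longrightarrow> \<bar>f r z\<bar> < e / c"
    using assms(1) \<open>c > 0\<close> unfolding vanishes_at_infinity_iff by (meson divide_pos_pos)
  have "\<bar>c * f (l * r) (l * z)\<bar> < e" if "r > 0" "R / l \<le> norm (r, z)" for r z
  proof -
    have "norm (l * r, l * z) = l * norm (r, z)"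
      using norm_scaleR[of l "(r, z)"] \<open>l > 0\<close> by simp
    then have "R \<le> norm (l * r, l * z)" using that(2) \<open>l > 0\<close> by (simp add: field_simps)
    then have "\<bar>f (l * r) (l * z)\<bar> < e / c" using that(1) \<open>l > 0\<close> by (intro R) auto
    then show ?thesis using \<open>c > 0\<close> by (simp add: abs_mult field_simps)
  qed
  then show "\<exists>R. \<forall>r>0. \<forall>z. R \<le> norm (r, z) \<longrightarrow> \<bar>c * f (l * r) (l * z)\<bar> < e" by blast
qed

text \<open>
  The exponent 3 balances $\lambda^3\cdot\lambda^2$ from the Laplacian on the left with
  $(\lambda^2)^2\cdot\lambda$ from the \<open>z\<close>-derivative of the square on the right.
\<close>

lemma decaying_poisson_solution_dilate:
  assumes f: "smooth5 f" and w: "decaying_poisson_solution f w" and "l > 0"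
  shows "decaying_poisson_solution (\<lambda>r z. l\<^sup>2 * f (l * r) (l * z)) (\<lambda>r z. l ^ 3 * w (l * r) (l * z))"
proof -
  have smw: "smooth5 w" and "vanishes_at_infinity w"
    and lap: "\<And>r z. r > 0 \<Longrightarrow> lap5 w r z = pd_z (\<lambda>r z. (f r z)\<^sup>2) r z"
    using w by (auto simp: decaying_poisson_solution_def)
  note f' = smooth5_imp_smooth_up_to_axis[OF f] and w' = smooth5_imp_smooth_up_to_axis[OF smw]
  note fl = smooth5_imp_smooth_up_to_axis[OF smooth5_dilate[OF f \<open>l > 0\<close>]]
  have "lap5 (\<lambda>r z. l ^ 3 * w (l * r) (l * z)) r z = pd_z (\<lambda>r z. (l\<^sup>2 * f (l * r) (l * z))\<^sup>2) r z"
    if "r > 0" for r z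
  proof -
    have lr: "l * r > 0" using \<open>r > 0\<close> \<open>l > 0\<close> by simp
    show ?thesis
      unfolding lap5_dilate[OF w' \<open>l > 0\<close> \<open>r > 0\<close>] lap[OF lr] pd_z_square[OF f' lr]
        pd_z_square[OF fl \<open>r > 0\<close>] pd_dilate(2)[OF f' \<open>l > 0\<close> \<open>r > 0\<close>]
      by (simp add: eval_nat_numeral)
  qed
  then show ?thesis
    unfolding decaying_poisson_solution_def
    using smooth5_dilate[OF smw \<open>l > 0\<close>] vanishes_at_infinity_dilate \<open>vanishes_at_infinity w\<close> \<open>l > 0\<close> by auto
qed

lemma lborel_integral_dilate:
  fixes k :: "real \<times> real \<Rightarrow> real"
  assumes [measurable]: "k \<in> borel_measurable borel" and "l > 0"
  shows "(LINT p|lborel. k p) = l\<^sup>2 * (LINT p|lborel. k (l *\<^sub>R p))"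
proof -
  have "(LINT p|lborel. k p) = (LINT p|density (distr lborel borel (\<lambda>x. 0 + l *\<^sub>R x)) (\<lambda>_. \<bar>l\<bar> ^ DIM(real \<times> real)). k p)"
    using lborel_affine[of l "0 :: real \<times> real"] \<open>l > 0\<close> by simp
  also have "\<dots> = (LINT p|distr lborel borel (\<lambda>x. 0 + l *\<^sub>R x). \<bar>l\<bar> ^ DIM(real \<times> real) *\<^sub>R k p)"
    by (rule integral_density) auto
  also have "\<dots> = (LINT p|lborel. \<bar>l\<bar> ^ DIM(real \<times> real) *\<^sub>R k (0 + l *\<^sub>R p))"
    by (rule integral_distr) auto
  also have "\<dots> = l\<^sup>2 * (LINT p|lborel. k (l *\<^sub>R p))"
    using \<open>l > 0\<close> by (simp add: power2_eq_square)
  finally show ?thesis .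
qed

text \<open>
  Two powers of \<open>l\<close> come from the plane and three from the weight.
\<close>

lemma integral_mu5_dilate:
  fixes g :: "real \<times> real \<Rightarrow> real"
  assumes g: "g \<in> borel_measurable mu5" and "l > 0"
  shows "integral\<^sup>L mu5 g = l ^ 5 * (\<integral>p. g (l *\<^sub>R p) \<partial>mu5)"
proof -
  have ind: "indicator half_plane (l *\<^sub>R p) = (indicator half_plane p :: real)" for p :: "real \<times> real"
    using \<open>l > 0\<close> by (cases p) (auto simp: indicator_def zero_less_mult_iff)
  define g' where "g' p = indicator half_plane p *\<^sub>R g p" for p
  have g'[measurable]: "g' \<in> borel_measurable borel"
    using g unfolding borel_measurable_mu5_iff g'_def .
  have "(\<lambda>p. g' (l *\<^sub>R p)) \<in> borel_measurable borel" by measurable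
  then have gl: "(\<lambda>p. g (l *\<^sub>R p)) \<in> borel_measurable mu5"
    unfolding borel_measurable_mu5_iff by (simp add: g'_def ind)
  define k where "k p = fst p ^ 3 * g' p" for p
  have "(\<lambda>p :: real \<times> real. fst p ^ 3) \<in> borel_measurable borel"
    by (auto intro!: borel_measurable_continuous_onI continuous_intros)
  then have k: "k \<in> borel_measurable borel" unfolding k_def by measurable
  have "integral\<^sup>L mu5 g = (LINT p|lborel. k p)"
    unfolding integral_mu5[OF g] set_lebesgue_integral_def k_def g'_def by (simp add: mult_ac)
  also have "\<dots> = l\<^sup>2 * (LINT p|lborel. k (l *\<^sub>R p))"
    by (rule lborel_integral_dilate[OF k \<open>l > 0\<close>])
  also have "(LINT p|lborel. k (l *\<^sub>R p)) = l ^ 3 * (LINT p:half_plane|lborel. fst p ^ 3 *\<^sub>R g (l *\<^sub>R p))"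
    unfolding set_lebesgue_integral_def integral_mult_right_zero[symmetric]
    by (intro Bochner_Integration.integral_cong refl) (simp add: k_def g'_def ind power_mult_distrib mult_ac)
  also have "(LINT p:half_plane|lborel. fst p ^ 3 *\<^sub>R g (l *\<^sub>R p)) = (\<integral>p. g (l *\<^sub>R p) \<partial>mu5)"
    by (rule integral_mu5[OF gl, symmetric])
  finally show ?thesis by (simp add: eval_nat_numeral)
qed

text \<open>
  Stated with the factor $l^3$ on the left, where it is the quotient of the Jacobian $l^5$ by the
  $l^2$ that the two differentiations produce.
\<close>

lemma L2norm_grad_dilate:
  assumes f: "smooth_up_to_axis f" and "l > 0"
  shows "l ^ 3 * (L2norm (grad (\<lambda>r z. c * f (l * r) (l * z))))\<^sup>2 = c\<^sup>2 * (L2norm (grad f))\<^sup>2"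
proof -
  let ?g = "\<lambda>(r, z). (norm (grad f r z))\<^sup>2"
  have "continuous_on half_plane ?g"
    unfolding norm_grad_power2 split_beta'
    by (intro continuous_intros smooth_up_to_axis_continuous_on[unfolded split_beta']
        smooth_up_to_axis_pd_r smooth_up_to_axis_pd_z f)
  then have g: "?g \<in> borel_measurable mu5" by (rule continuous_on_imp_measurable_mu5)
  have "(L2norm (grad (\<lambda>r z. c * f (l * r) (l * z))))\<^sup>2 = (\<integral>p. (c * l)\<^sup>2 * ?g (l *\<^sub>R p) \<partial>mu5)"
    unfolding L2norm_power2 norm_grad_power2
    by (intro Bochner_Integration.integral_cong refl)
      (auto simp: space_mu5 pd_dilate[OF f \<open>l > 0\<close>] power_mult_distrib distrib_left)
  also have "\<dots> = (c * l)\<^sup>2 * (\<integral>p. ?g (l *\<^sub>R p) \<partial>mu5)" by simp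
  finally have "l ^ 3 * (L2norm (grad (\<lambda>r z. c * f (l * r) (l * z))))\<^sup>2
      = c\<^sup>2 * (l ^ 5 * (\<integral>p. ?g (l *\<^sub>R p) \<partial>mu5))"
    by (simp add: power_mult_distrib eval_nat_numeral)
  also have "l ^ 5 * (\<integral>p. ?g (l *\<^sub>R p) \<partial>mu5) = (L2norm (grad f))\<^sup>2"
    unfolding L2norm_power2 by (rule integral_mu5_dilate[OF g \<open>l > 0\<close>, symmetric])
  finally show ?thesis .
qed

section \<open>Energy balance and scaling\<close>

theorem proposition6p1:
  fixes \<nu> :: real and I :: "real set" and F W :: "real \<Rightarrow> real \<Rightarrow> real \<Rightarrow> real"
  assumes "\<nu> > 0"
    and "open I"
    and "solves_system \<nu> I F W"
    and "\<And>t. t \<in> I \<Longrightarrow> in_L2 (F t) \<and> in_L2 (grad (F t)) \<and> in_L2 (grad (W t))"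
    and "dominated_time_derivative I F"
    and "\<And>t. t \<in> I \<Longrightarrow> integrable_fluxes (F t) (W t)"
  shows "(\<forall>t\<in>I.
      (\<lambda>s. (L2norm (F s))\<^sup>2) differentiable (at t) \<and>
      1 / 2 * deriv (\<lambda>s. (L2norm (F s))\<^sup>2) t + \<nu> * (L2norm (grad (F t)))\<^sup>2
        = 2 * (L2norm (grad (W t)))\<^sup>2) \<and>
    (\<forall>l>0. \<forall>t. l\<^sup>2 * t \<in> I \<longrightarrow>
      (\<exists>V. decaying_poisson_solution (rescale l F t) V) \<and>
      (\<forall>V. decaying_poisson_solution (rescale l F t) V \<longrightarrow>
         (L2norm (grad V))\<^sup>2 = l ^ 3 * (L2norm (grad (W (l\<^sup>2 * t))))\<^sup>2) \<and>
      (L2norm (grad (rescale l F t)))\<^sup>2 = l * (L2norm (grad (F (l\<^sup>2 * t))))\<^sup>2)"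
proof (intro conjI)
  note sol = \<open>solves_system \<nu> I F W\<close>[unfolded solves_system_def]
  have sm5: "smooth5 (F t)" and poisson: "decaying_poisson_solution (F t) (W t)" if "t \<in> I" for t
    using sol that by auto
  note smF = smooth5_imp_smooth_up_to_axis[OF sm5]
  have smW: "smooth_up_to_axis (W t)" if "t \<in> I" for t
    using poisson[OF that] smooth5_imp_smooth_up_to_axis by (auto simp: decaying_poisson_solution_def)
  define Ft where "Ft t r z = deriv (\<lambda>s. F s r z) t" for t r z
  have DF: "((\<lambda>s. F s r z) has_real_derivative Ft t r z) (at t)" if "t \<in> I" "r > 0" for t r z
    using sol that unfolding Ft_def by (simp add: DERIV_deriv_iff_real_differentiable)
  have transport: "Ft t r z + b4 (W t) r z \<bullet> grad (F t) r z =
      \<nu> * lap5 (F t) r z + 2 * pd_z (W t) r z * F t r z" if "t \<in> I" "r > 0" for t r z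
    using sol that unfolding Ft_def by blast
  have DF2: "((\<lambda>s. (F s r z)\<^sup>2) has_real_derivative 2 * (F t r z * Ft t r z)) (at t)" if "t \<in> I" "r > 0" for t r z
    by (rule derivative_eq_intros refl DF[OF that])+ simp
  show "\<forall>t\<in>I. (\<lambda>s. (L2norm (F s))\<^sup>2) differentiable (at t) \<and>
      1 / 2 * deriv (\<lambda>s. (L2norm (F s))\<^sup>2) t + \<nu> * (L2norm (grad (F t)))\<^sup>2 = 2 * (L2norm (grad (W t)))\<^sup>2"
  proof
    fix t assume "t \<in> I"
    note Fr = smooth_up_to_axis_pd_r[OF smF[OF \<open>t \<in> I\<close>]] and Fz = smooth_up_to_axis_pd_z[OF smF[OF \<open>t \<in> I\<close>]]
    note Wr = smooth_up_to_axis_pd_r[OF smW[OF \<open>t \<in> I\<close>]] and Wz = smooth_up_to_axis_pd_z[OF smW[OF \<open>t \<in> I\<close>]]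
    obtain \<delta> h where "\<delta> > 0" and h: "integrable mu5 h"
      and bound: "\<And>s r z. s \<in> I \<Longrightarrow> \<bar>s - t\<bar> < \<delta> \<Longrightarrow> r > 0 \<Longrightarrow> \<bar>deriv (\<lambda>\<tau>. (F \<tau> r z)\<^sup>2) s\<bar> \<le> h (r, z)"
      using assms(5)[unfolded dominated_time_derivative_def, THEN bspec, OF \<open>t \<in> I\<close>] by blast
    let ?f = "\<lambda>s (r, z). (F s r z)\<^sup>2" and ?f' = "\<lambda>s (r, z). 2 * (F s r z * Ft s r z)"
    have meas: "?f' t \<in> borel_measurable mu5"
    proof -
      note cont = smF[OF \<open>t \<in> I\<close>] smW[OF \<open>t \<in> I\<close>] Fr Fz Wr Wz
        smooth_up_to_axis_pd_r[OF Fr] smooth_up_to_axis_pd_z[OF Fz]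
      note cont = cont[THEN smooth_up_to_axis_continuous_on, unfolded split_beta']
      have "continuous_on half_plane (\<lambda>(r, z). 2 * (F t r z * (\<nu> * lap5 (F t) r z + 2 * pd_z (W t) r z * F t r z
          - b4 (W t) r z \<bullet> grad (F t) r z)))" (is "continuous_on _ ?rhs")
        unfolding lap5_def b4_def grad_def inner_Pair split_beta' inner_real_def
        by (intro continuous_intros cont) auto
      moreover have "?rhs p = ?f' t p" if "p \<in> half_plane" for p
        using that by (auto simp flip: transport[OF \<open>t \<in> I\<close>])
      ultimately have "continuous_on half_plane (?f' t)"
        by (rule continuous_on_eq)
      then show ?thesis by (rule continuous_on_imp_measurable_mu5)
    qed
    have int: "integrable mu5 (?f s)" if "s \<in> I" for s
      using assms(4)[OF that] by (simp add: in_L2_def)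
    have deriv: "((\<lambda>s. ?f s p) has_real_derivative ?f' s p) (at s)" if "s \<in> I" "p \<in> space mu5" for s p
      using that DF2 by (auto simp: space_mu5)
    have bound': "\<bar>?f' s p\<bar> \<le> h p" if "s \<in> I" "\<bar>s - t\<bar> < \<delta>" "p \<in> space mu5" for s p
      using that bound[OF that(1,2)] DERIV_imp_deriv[OF DF2[OF that(1)]] by (auto simp: space_mu5)
    note D = has_derivative_integral_dominated[where f = ?f and f' = ?f', OF \<open>open I\<close> \<open>t \<in> I\<close> \<open>\<delta> > 0\<close> int deriv h bound' meas]
    have eq: "(\<integral>p. ?f' t p \<partial>mu5) = 2 * (\<integral>(r, z). F t r z * Ft t r z \<partial>mu5)"
      by (simp add: split_beta')
    have D1: "((\<lambda>s. (L2norm (F s))\<^sup>2) has_real_derivative 2 * (\<integral>(r, z). F t r z * Ft t r z \<partial>mu5)) (at t)"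
      using D(1) unfolding eq by (simp add: L2norm_power2)
    have int_ft: "integrable mu5 (\<lambda>(r, z). F t r z * Ft t r z)"
      using D(2) by (simp add: split_beta')
    obtain B where B: "\<And>r z. r > 0 \<Longrightarrow> \<bar>W t r z\<bar> \<le> B"
      using vanishes_at_infinity_imp_bounded[OF smW[OF \<open>t \<in> I\<close>]] poisson[OF \<open>t \<in> I\<close>]
      by (auto simp: decaying_poisson_solution_def)
    have "(\<integral>(r, z). F t r z * Ft t r z \<partial>mu5) + \<nu> * (L2norm (grad (F t)))\<^sup>2 = 2 * (L2norm (grad (W t)))\<^sup>2"
      by (rule energy_identity[OF smF[OF \<open>t \<in> I\<close>] smW[OF \<open>t \<in> I\<close>] _ transport[OF \<open>t \<in> I\<close>] _ _ _ assms(6)[OF \<open>t \<in> I\<close>] B int_ft])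
        (use poisson[OF \<open>t \<in> I\<close>] assms(4)[OF \<open>t \<in> I\<close>] in \<open>auto simp: decaying_poisson_solution_def\<close>)
    moreover have "(\<lambda>s. (L2norm (F s))\<^sup>2) differentiable (at t)"
      using D1 real_differentiable_def by blast
    ultimately show "(\<lambda>s. (L2norm (F s))\<^sup>2) differentiable (at t) \<and>
      1 / 2 * deriv (\<lambda>s. (L2norm (F s))\<^sup>2) t + \<nu> * (L2norm (grad (F t)))\<^sup>2 = 2 * (L2norm (grad (W t)))\<^sup>2"
      unfolding DERIV_imp_deriv[OF D1] by simp
  qed
  show "\<forall>l>0. \<forall>t. l\<^sup>2 * t \<in> I \<longrightarrow>
      (\<exists>V. decaying_poisson_solution (rescale l F t) V) \<and>
      (\<forall>V. decaying_poisson_solution (rescale l F t) V \<longrightarrow>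
         (L2norm (grad V))\<^sup>2 = l ^ 3 * (L2norm (grad (W (l\<^sup>2 * t))))\<^sup>2) \<and>
      (L2norm (grad (rescale l F t)))\<^sup>2 = l * (L2norm (grad (F (l\<^sup>2 * t))))\<^sup>2"
  proof (intro allI impI)
    fix l t :: real
    assume "l > 0" and lt: "l\<^sup>2 * t \<in> I"
    let ?V = "\<lambda>r z. l ^ 3 * W (l\<^sup>2 * t) (l * r) (l * z)"
    have F': "rescale l F t = (\<lambda>r z. l\<^sup>2 * F (l\<^sup>2 * t) (l * r) (l * z))"
      by (simp add: rescale_def fun_eq_iff)
    have V: "decaying_poisson_solution (rescale l F t) ?V"
      unfolding F' by (rule decaying_poisson_solution_dilate[OF sm5[OF lt] poisson[OF lt] \<open>l > 0\<close>])
    have V_norm: "(L2norm (grad ?V))\<^sup>2 = l ^ 3 * (L2norm (grad (W (l\<^sup>2 * t))))\<^sup>2"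
    proof -
      have "l ^ 3 * (L2norm (grad ?V))\<^sup>2 = l ^ 3 * (l ^ 3 * (L2norm (grad (W (l\<^sup>2 * t))))\<^sup>2)"
        using L2norm_grad_dilate[OF smW[OF lt] \<open>l > 0\<close>, of "l ^ 3"]
        unfolding power2_eq_square[of "l ^ 3"] mult.assoc .
      then show ?thesis
        by (rule mult_left_cancel[THEN iffD1, rotated]) (use \<open>l > 0\<close> in simp)
    qed
    have F_norm: "(L2norm (grad (rescale l F t)))\<^sup>2 = l * (L2norm (grad (F (l\<^sup>2 * t))))\<^sup>2"
      using L2norm_grad_dilate[OF smF[OF lt] \<open>l > 0\<close>, of "l\<^sup>2"] \<open>l > 0\<close>
      by (simp add: F' eval_nat_numeral)
    show "(\<exists>V. decaying_poisson_solution (rescale l F t) V) \<and>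
      (\<forall>V. decaying_poisson_solution (rescale l F t) V \<longrightarrow>
         (L2norm (grad V))\<^sup>2 = l ^ 3 * (L2norm (grad (W (l\<^sup>2 * t))))\<^sup>2) \<and>
      (L2norm (grad (rescale l F t)))\<^sup>2 = l * (L2norm (grad (F (l\<^sup>2 * t))))\<^sup>2"
    proof (intro conjI allI impI)
      show "\<exists>V. decaying_poisson_solution (rescale l F t) V" using V by blast
      show "(L2norm (grad (rescale l F t)))\<^sup>2 = l * (L2norm (grad (F (l\<^sup>2 * t))))\<^sup>2" by (rule F_norm)
      fix V' assume "decaying_poisson_solution (rescale l F t) V'"
      from L2norm_grad_cong[OF decaying_poisson_solution_unique[OF this V]] V_norm
      show "(L2norm (grad V'))\<^sup>2 = l ^ 3 * (L2norm (grad (W (l\<^sup>2 * t))))\<^sup>2" by simp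
    qed
  qed
qed

end
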